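(* (Connection formula for the transplantation of an edge.) Let $1\le s<r<h$ and let $\mathcal{T}',\mathcal{T}'',\mathcal{T}'''$ be rooted binary trees with $s$, $r-s$, $h-r$ leaves respectively. Let $\mathcal{S}_1$ be the tree whose root has left subtree $\mathcal{T}'$ and whose right son $Z$ has left subtree $\mathcal{T}''$ and right subtree $\mathcal{T}'''$; let $\mathcal{S}_2$ be the tree whose root has right subtree $\mathcal{T}'''$ and whose left son $W$ has left subtree $\mathcal{T}'$ and right subtree $\mathcal{T}''$. Let $0\le n\le N$, let $i,l,j\ge0$ with $i+l+j\le n$, and fix $\mathrm{c}'\in\mathrm{CL}(\mathcal{T}',i)$, $\mathrm{c}''\in\mathrm{CL}(\mathcal{T}'',l)$, $\mathrm{c}'''\in\mathrm{CL}(\mathcal{T}''',j)$. For $l+j\le v\le n-i$ let $\Xi_v\in V_{h,N}$ be the multidimensional $q$-Hahn polynomial (with parameters $\alpha_1,\dots,\alpha_h$) associated to $\mathcal{S}_1$ with the labeling that is $n-v-i$ at the root, $v-l-j$ at $Z$, and $\mathrm{c}',\mathrm{c}'',\mathrm{c}'''$ on the three subtrees. For $i+l\le u\le n-j$ let $\Theta_u\in V_{h,N}$ be the one associated to $\mathcal{S}_2$ with the labeling that is $n-u-j$ at the root, $u-i-l$ at $W$, and $\mathrm{c}',\mathrm{c}'',\mathrm{c}'''$ on the three subtrees. Then, for $l+j\le v\le n-i$, $$\Xi_v=q^{-i(v-l-j)}\sum_{u=i+l}^{n-j}r_{u-i-l}\bigl(v-l-j;\,A_s^{-1}A_rq^{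r-s+2l-1},\,A_sq^{s+2i-1},\,A_s^{-1}A_hq^{n+l+j-i+h-s-1},\,n-i-l-j\,|\,q\bigr)\,\Theta_u.$$
   Context: Let $0<q<1$, let $h\ge3$ and $N\ge1$ be integers, and let $\alpha_1,\dots,\alpha_h$ be real numbers such that either $0<\alpha_i<q^{-1}$ for all $i$, or $\alpha_i>q^{-N}$ for all $i$. Write $(a;q)_k=\prod_{j=0}^{k-1}(1-aq^j)$. $[h;N]$ is the set of $\mathbf{x}=(x_1,\dots,x_h)$ with $x_i$ nonnegative integers and $x_1+\cdots+x_h=N$; $V_{h,N}$ is the space of complex functions on $[h;N]$. Put $X_k=x_1+\cdots+x_k$, $A_k=\alpha_1\cdots\alpha_k$. One-variable $q$-Hahn polynomials: for $0\le n\le N'$, $0\le x\le N'$, $$Q_n(x;\alpha,\beta,N'|q)=q^{-nN'+n^2/2}\frac{(q;q)_{N'}}{(q;q)_{N'-n}}\sum_{k=0}^{n}\frac{(q^{-n};q)_k(\alpha\beta q^{n+1};q)_k(q^{-x};q)_k}{(\alpha q;q)_k(q^{-N'};q)_k(q;q)_k}\,q^k.$$ One-variable $q$-Racah polynomials: for $0\le n\le N'$, $0\le x\le N'$, $$r_n(x;\alpha,\beta,\delta,N'|q)=q^{-n(N'-n)}\frac{(\beta\delta q;q)_n(q^{N'-n+1};q)_n}{(\alpha\beta q^{n+1};q)_n(q;q)_n}\sum_{k=0}^{n}\frac{(q^{-n};q)_k(\delta q^{x-N'};q)_k(q^{-x};q)_k(\alpha\beta q^{n+1};q)_k}{(\alpha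 q;q)_k(\beta\delta q;q)_k(q^{-N'};q)_k(q;q)_k}\,q^k.$$ A rooted binary tree is a planar rooted tree in which every vertex is either a leaf or has exactly two sons (left and right); a single vertex is allowed. In a tree with $h$ leaves, the leaves are numbered $1,\dots,h$ from left to right, leaf $k$ carrying the parameter $\alpha_k$ and the variable $x_k$. A coefficients labeling $\mathrm{c}$ of $\mathcal{T}$ assigns a nonnegative integer to each internal (non-leaf) vertex and $0$ to each leaf; $\mathrm{CL}(\mathcal{T},n)$ is the set of those whose labels have sum $n$. Multidimensional $q$-Hahn polynomials: let $\mathcal{T}$ be a rooted binary tree with $h$ leaves, $\mathcal{T}_1,\mathcal{T}_2$ its left and right subtrees at the root, $t$ the number of leaves of $\mathcal{T}_1$, $\mathrm{c}\in\mathrm{CL}(\mathcal{T},n)$, $\mathrm{c}_1,\mathrm{c}_2$ its restrictions to $\mathcal{T}_1,\mathcal{T}_2$, and $i,j$ the sums of the labels of $\mathrm{c}_1,\mathrm{c}_2$. Recursively, $$Q_{\mathrm{c}}(\mathbf{x};\alpha_1,\dots,\alpha_h,X_h|q)=q^{-jX_t}Q_{n-i-j}(X_t-i;A_tq^{t+2i-1},A_hA_t^{-1}q^{h-t+2j-1},X_h-i-j|q)$$ $$\qquad\times Q_{\mathrm{c}_1}(x_1,\dots,x_t;\alpha_1,\dots,\alpha_t,X_t|q)\,Q_{\mathrm{c}_2}(x_{t+1},\dots,x_h;\alpha_{t+1},\dots,\alpha_h,X_h-X_t|q)$$ if $X_h\ge n$, $X_t\ge i$, $X_h-X_t\ge j$,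 and $Q_{\mathrm{c}}=0$ otherwise; for a single-vertex tree the polynomial is the constant $1$. The polynomial in $V_{h,N}$ is the one with $X_h=N$. *)

theory Defs
  imports Complex_Main
begin

definition qpoch :: "real \<Rightarrow> real \<Rightarrow> nat \<Rightarrow> real" where
  "qpoch a q k = (\<Prod>j<k. 1 - a * q ^ j)"

(* Meaningful for n \<le> N and x \<le> N; the value outside this range is irrelevant.
   The half-integer power q^(n^2/2) is the reason for powr. *)
definition q_Hahn :: "nat \<Rightarrow> nat \<Rightarrow> real \<Rightarrow> real \<Rightarrow> nat \<Rightarrow> real \<Rightarrow> real" where
  "q_Hahn n x \<alpha> \<beta> N q =
     q powr (- (real n * real N) + (real n)\<^sup>2 / 2) * (qpoch q q N / qpoch q q (N - n)) *
     (\<Sum>k=0..n. (qpoch (q powi (- int n)) q k * qpoch (\<alpha> * \<beta> * q ^ (n + 1)) q k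
                  * qpoch (q powi (- int x)) q k)
               / (qpoch (\<alpha> * q) q k * qpoch (q powi (- int N)) q k * qpoch q q k) * q ^ k)"

(* Meaningful for n \<le> N and x \<le> N. *)
definition q_Racah :: "nat \<Rightarrow> nat \<Rightarrow> real \<Rightarrow> real \<Rightarrow> real \<Rightarrow> nat \<Rightarrow> real \<Rightarrow> real" where
  "q_Racah n x \<alpha> \<beta> \<delta> N q =
     q powi (- (int n * (int N - int n))) *
     ((qpoch (\<beta> * \<delta> * q) q n * qpoch (q powi (int N - int n + 1)) q n)
      / (qpoch (\<alpha> * \<beta> * q ^ (n + 1)) q n * qpoch q q n)) *
     (\<Sum>k=0..n. (qpoch (q powi (- int n)) q k * qpoch (\<delta> * q powi (int x - int N)) q k
                  * qpoch (q powi (- int x)) q k * qpoch (\<alpha> * \<beta> * q ^ (n + 1)) q k)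
               / (qpoch (\<alpha> * q) q k * qpoch (\<beta> * \<delta> * q) q k
                  * qpoch (q powi (- int N)) q k * qpoch q q k) * q ^ k)"

datatype bintree = Leaf | Node bintree bintree

fun leaves :: "bintree \<Rightarrow> nat" where
  "leaves Leaf = 1"
| "leaves (Node l r) = leaves l + leaves r"

(* A coefficients labeling is stored together with its tree: a natural number at every
   internal vertex.  Leaves carry the label 0, which is left implicit. *)
datatype labeling = LLeaf | LNode nat labeling labeling

fun tree_of :: "labeling \<Rightarrow> bintree" where
  "tree_of LLeaf = Leaf"
| "tree_of (LNode m c1 c2) = Node (tree_of c1) (tree_of c2)"

fun label_sum :: "labeling \<Rightarrow> nat" where
  "label_sum LLeaf = 0"
| "label_sum (LNode m c1 c2) = m + label_sum c1 + label_sum c2"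

definition CL :: "bintree \<Rightarrow> nat \<Rightarrow> labeling set" where
  "CL T n = {c. tree_of c = T \<and> label_sum c = n}"

(* The set [h;N].  Tuples (x_1,...,x_h) and (\<alpha>_1,...,\<alpha>_h) are lists of length h, so that
   X_k = psum x k and A_k = pprod \<alpha> k, and a subtree simply receives a sublist. *)
definition compositions :: "nat \<Rightarrow> nat \<Rightarrow> nat list set" where
  "compositions h N = {x. length x = h \<and> sum_list x = N}"

definition psum :: "nat list \<Rightarrow> nat \<Rightarrow> nat" where
  "psum x k = sum_list (take k x)"

definition pprod :: "real list \<Rightarrow> nat \<Rightarrow> real" where
  "pprod \<alpha> k = prod_list (take k \<alpha>)"

(* The labeling c determines the tree, and the last argument X_h of Q_c(x; \<alpha>, X_h | q) is
   computed from x.  All natural-number subtractions are exact under the guard. *)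
fun multi_q_Hahn :: "real \<Rightarrow> labeling \<Rightarrow> real list \<Rightarrow> nat list \<Rightarrow> real" where
  "multi_q_Hahn q LLeaf \<alpha> x = 1"
| "multi_q_Hahn q (LNode m c1 c2) \<alpha> x =
     (let t = leaves (tree_of c1); h = t + leaves (tree_of c2);
          i = label_sum c1; j = label_sum c2; n = label_sum (LNode m c1 c2);
          Xt = psum x t; Xh = psum x h; At = pprod \<alpha> t; Ah = pprod \<alpha> h
      in if n \<le> Xh \<and> i \<le> Xt \<and> j \<le> Xh - Xt then
           q powi (- (int j * int Xt))
           * q_Hahn (n - i - j) (Xt - i)
               (At * q powi (int t + 2 * int i - 1))
               (Ah * inverse At * q powi (int h - int t + 2 * int j - 1))
               (Xh - i - j) q
           * multi_q_Hahn q c1 (take t \<alpha>) (take t x)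
           * multi_q_Hahn q c2 (drop t \<alpha>) (drop t x)
         else 0)"

(* The same polynomial as an element of V_{h,N}: a complex function, considered on
   compositions h N only. *)
definition q_Hahn_V :: "real \<Rightarrow> labeling \<Rightarrow> real list \<Rightarrow> nat list \<Rightarrow> complex" where
  "q_Hahn_V q c \<alpha> x = complex_of_real (multi_q_Hahn q c \<alpha> x)"

end

(* Put A = A_s q^(s+2i), B = A_r/A_s q^(r-s+2l), C = A_h/A_r q^(h-r+2j), M = n-i-l-j and
   (a, b, c) = (X_s - i, X_r - X_s - l, N - X_r - j).  After removing the factors coming from the
   three common subtrees, both sides are functions of three boxes (a, b, c).  A raising operator
   a + b + c -> a + b + c + 1, independent of the parameters, multiplies both sides by the same
   constant, so it suffices to treat a + b + c = M.  There both sides are annihilated by a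
   lowering operator, a first order recursion in a, so it suffices to treat a = 0.  In that case
   the q-Hahn polynomials of top degree are explicit products, and comparing the two sides
   termwise leaves a single terminating sum, which telescopes by a WZ certificate. *)
theory Submission
  imports Defs
begin

section \<open>Shifted factorials and one-variable polynomials\<close>

text \<open>A subtree enters the tree recursion only through its number of leaves, the product of
  its parameters, its label sum and the sum of its variables, so it acts as one box whose content is
  reduced by the label sum. Both operators respect both bracketings because the constant produced by
  the inner pair is exactly the weight of a merged box: content \<open>b + c - w\<close> and
  parameter \<open>B * C * q ^ (2 * w)\<close>, or the mirror image. Lowering from total M leads to
  total M - 1, where a polynomial of degree M is 0; this is why both sides are annihilated. Above
  total M the raising constant is nonzero, so values at one total determine those at the next. For a
  = 0 the q-Racah summand splits into a factor in w, the coefficient of the inner q-Hahn polynomial,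
  and a factor in y, so the sum over y can be evaluated for each k separately. The two ranges
  allowed for the parameters keep A q^j, B q^j, A B q^j and A B C q^(M-1+j) away from 1 for the
  exponents j that occur in denominators.\<close>

lemma qpoch_0 [simp]: "qpoch a q 0 = 1"
  by (simp add: qpoch_def)

lemma qpoch_Suc: "qpoch a q (Suc k) = qpoch a q k * (1 - a * q ^ k)"
  by (simp add: qpoch_def)

lemma qpoch_add: "qpoch a q (m + k) = qpoch a q m * qpoch (a * q ^ m) q k"
  by (induction k) (simp_all add: qpoch_Suc power_add mult_ac)

lemma qpoch_Suc_shift: "qpoch a q (Suc k) = (1 - a) * qpoch (a * q) q k"
  using qpoch_add[of a q 1 k] by (simp add: qpoch_Suc)

lemma qpoch_eq_0_iff: "qpoch a q k = 0 \<longleftrightarrow> (\<exists>j<k. a * q ^ j = 1)"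
  by (auto simp: qpoch_def)

lemma qpoch_nonzero: "(\<And>j. j < k \<Longrightarrow> a * q ^ j \<noteq> 1) \<Longrightarrow> qpoch a q k \<noteq> 0"
  by (auto simp: qpoch_eq_0_iff)

section \<open>q-Hahn polynomials as functions of two boxes\<close>

definition hahn_norm :: "real \<Rightarrow> nat \<Rightarrow> nat \<Rightarrow> real" where
  "hahn_norm q n N =
     q powr (- (real n * real N) + (real n)\<^sup>2 / 2) * (qpoch q q N / qpoch q q (N - n))"

text \<open>The part of the summand that involves neither x nor N, with P for A B, so that \<alpha>
  \<beta> q^(n+1) becomes P q^(n-1). It is kept apart because the same coefficients occur in the
  q-Racah sum.\<close>

definition hahn_coeff :: "real \<Rightarrow> nat \<Rightarrow> real \<Rightarrow> real \<Rightarrow> nat \<Rightarrow> real" where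
  "hahn_coeff q n A P k =
     qpoch (inverse (q ^ n)) q k * qpoch (P * q ^ n / q) q k / (qpoch A q k * qpoch q q k) * q ^ k"

definition hahn_sum :: "real \<Rightarrow> nat \<Rightarrow> real \<Rightarrow> real \<Rightarrow> nat \<Rightarrow> nat \<Rightarrow> real" where
  "hahn_sum q n A P x N =
     (\<Sum>k\<le>n. hahn_coeff q n A P k * qpoch (inverse (q ^ x)) q k / qpoch (inverse (q ^ N)) q k)"

text \<open>Here \<open>A = \<alpha> q\<close>, \<open>B = \<beta> q\<close>, \<open>a = x\<close> and \<open>b = N - x\<close>; the value \<open>0\<close> for \<open>n > N\<close> makes the raising
  and lowering relations hold without exceptions.\<close>

definition hahn :: "real \<Rightarrow> real \<Rightarrow> real \<Rightarrow> nat \<Rightarrow> nat \<Rightarrow> nat \<Rightarrow> real" where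
  "hahn q A B n a b =
     (if n \<le> a + b then hahn_norm q n (a + b) * hahn_sum q n A (A * B) a (a + b) else 0)"

text \<open>The k-th summand of \<open>hahn_lower_sum\<close> without its common factors, with X =
  q^a, Y = q^b, \<kappa> = q^k, \<nu> = q^n. The three terms on the right stand for the multiple of
  the summand, for U (k + 1) and for U k; the factor 1 - \<kappa>/Q clears the denominator of U (k +
  1).\<close>

lemma hahn_lower_key:
  fixes A B X Y \<kappa> \<nu> q :: real
  assumes "q \<noteq> 0" "X \<noteq> 0" "Y \<noteq> 0" "\<kappa> \<noteq> 0" "\<nu> \<noteq> 0" "Q = q * X * Y" "Q \<noteq> 1"
  shows "((1 - A * X) * (1 - 1 / (q * X)) + A * X * (1 - B * Y) * (1 - \<kappa> / (q * X))) * (1 - \<kappa> / Q)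
   = (\<nu> - Q) * (1 - A * B * \<nu> * X * Y) / (\<nu> * (1 - Q)) * (1 - 1 / Q) * (1 - \<kappa> / (q * X))
     + (1 - \<kappa> / \<nu>) * (1 - A * B * \<nu> * \<kappa> / q) / \<kappa> * (1 - \<kappa> / (q * X))
     - (1 - A * \<kappa> / q) * (1 - \<kappa>) / \<kappa> * (1 - \<kappa> / Q)"
proof -
  have 1: "(\<nu> - Q) * (1 - A * B * \<nu> * X * Y) / (\<nu> * (1 - Q)) * (1 - 1 / Q)
     = - (\<nu> - Q) * (1 - A * B * \<nu> * X * Y) / (\<nu> * Q)"
    using assms by (simp add: divide_simps) (simp add: algebra_simps)
  \<comment> \<open>Once 1 - Q is cancelled, only monomials are left in denominators. With names for
    the reciprocals the claim is a polynomial identity modulo p q = 1, x X = 1 and so on.\<close>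
  define p x y k n where "p = 1 / q" and "x = 1 / X" and "y = 1 / Y" and "k = 1 / \<kappa>" and "n = 1 / \<nu>"
  have e: "p * q = 1" "x * X = 1" "y * Y = 1" "k * \<kappa> = 1" "n * \<nu> = 1"
    using assms by (simp_all add: p_def x_def y_def k_def n_def)
  have Q: "1 / Q = p * x * y" "1 / (q * X) = p * x" by (simp_all add: assms(6) p_def x_def y_def)
  have "((1 - A * X) * (1 - p * x) + A * X * (1 - B * Y) * (1 - \<kappa> * (p * x))) * (1 - \<kappa> * (p * x * y))
   = - (\<nu> - q * X * Y) * (1 - A * B * \<nu> * X * Y) * (n * (p * x * y)) * (1 - \<kappa> * (p * x))
     + (1 - \<kappa> * n) * (1 - A * B * \<nu> * \<kappa> * p) * k * (1 - \<kappa> * (p * x))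
     - (1 - A * \<kappa> * p) * (1 - \<kappa>) * k * (1 - \<kappa> * (p * x * y))"
    using e by algebra
  then show ?thesis
    unfolding 1 unfolding assms(6) by (simp add: p_def x_def y_def k_def n_def)
qed

text \<open>The summand k = 0, where no term U k comes in from below.\<close>

lemma hahn_lower_key_0:
  fixes A B X Y \<nu> q :: real
  assumes "q \<noteq> 0" "X \<noteq> 0" "Y \<noteq> 0" "\<nu> \<noteq> 0" "Q = q * X * Y" "Q \<noteq> 1"
  shows "1 - A * B * X * Y = (\<nu> - Q) * (1 - A * B * \<nu> * X * Y) / (\<nu> * (1 - Q))
     + (1 - 1 / \<nu>) * (1 - A * B * \<nu> / q) / (1 - 1 / Q)"
proof -
  define Q' where "Q' = 1 - 1 / Q"
  define \<Delta> where "\<Delta> = Q - \<nu>"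
  have Q0: "Q \<noteq> 0" and Q'0: "Q' \<noteq> 0" using assms by (simp_all add: Q'_def field_simps)
  have Q1: "\<nu> * (1 - Q) = - (\<nu> * Q * Q')" using Q0 by (simp add: Q'_def field_simps)
  have \<Delta>: "\<nu> - Q = - \<Delta>" by (simp add: \<Delta>_def)
  define p x y n where "p = 1 / q" and "x = 1 / X" and "y = 1 / Y" and "n = 1 / \<nu>"
  have e: "p * q = 1" "x * X = 1" "y * Y = 1" "n * \<nu> = 1"
    using assms by (simp_all add: p_def x_def y_def n_def)
  have "(1 - A * B * X * Y) * (1 - p * x * y) =
     (q * X * Y - \<nu>) * (1 - A * B * \<nu> * X * Y) * (n * (p * x * y)) + (1 - n) * (1 - A * B * \<nu> * p)"
    using e by algebra
  then have "(1 - A * B * X * Y) * Q' =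
     \<Delta> * (1 - A * B * \<nu> * X * Y) / (\<nu> * Q) + (1 - 1 / \<nu>) * (1 - A * B * \<nu> / q)"
    unfolding Q'_def \<Delta>_def assms(5) by (simp add: p_def x_def y_def n_def)
  then have "1 - A * B * X * Y
     = (\<Delta> * (1 - A * B * \<nu> * X * Y) / (\<nu> * Q) + (1 - 1 / \<nu>) * (1 - A * B * \<nu> / q)) / Q'"
    using Q'0 by (simp add: eq_divide_eq)
  then show ?thesis
    unfolding Q1 \<Delta> by (simp add: add_divide_distrib flip: Q'_def)
qed

lemma sum_atMost_add_drop:
  fixes f :: "nat \<Rightarrow> 'a::comm_monoid_add"
  assumes "\<And>y. y < k \<Longrightarrow> f y = 0"
  shows "(\<Sum>y\<le>k + m. f y) = (\<Sum>z\<le>m. f (k + z))"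
  using assms
proof (induction k arbitrary: f)
  case (Suc k)
  have "(\<Sum>y\<le>Suc k + m. f y) = (\<Sum>y\<le>k + m. f (Suc y))"
    using Suc.prems[of 0] by (simp only: add_Suc sum.atMost_Suc_shift) simp
  also have "\<dots> = (\<Sum>z\<le>m. f (Suc (k + z)))"
    using Suc.prems by (intro Suc.IH) simp
  finally show ?case by simp
qed simp

text \<open>The power of q comes from q^(-j X_t) in the tree recursion, with w as the label sum on
  the right; in the other bracketing a bare box stands on the right, so there is none. For w > b + c
  the truncated difference is harmless, since the inner \<open>hahn\<close> is then 0.\<close>

definition right_nested :: "real \<Rightarrow> real \<Rightarrow> real \<Rightarrow> real \<Rightarrow> nat \<Rightarrow> nat \<Rightarrow> nat \<Rightarrow> nat \<Rightarrow> nat \<Rightarrow> real" where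
  "right_nested q A B C M w a b c =
     hahn q A (B * C * q ^ (2 * w)) (M - w) a (b + c - w) * hahn q B C w b c / q ^ (w * a)"

definition left_nested :: "real \<Rightarrow> real \<Rightarrow> real \<Rightarrow> real \<Rightarrow> nat \<Rightarrow> nat \<Rightarrow> nat \<Rightarrow> nat \<Rightarrow> nat \<Rightarrow> real" where
  "left_nested q A B C M y a b c =
     hahn q (A * B * q ^ (2 * y)) C (M - y) (a + b - y) c * hahn q A B y a b"

text \<open>Writing \<open>raise3\<close> and \<open>lower3\<close> as two-box operators in the variables \<open>(b, c)\<close> nested into
  two-box operators in \<open>(a, b + c)\<close> makes them compatible with both bracketings of the three
  boxes.\<close>

definition raise3 :: "real \<Rightarrow> (nat \<Rightarrow> nat \<Rightarrow> nat \<Rightarrow> real) \<Rightarrow> nat \<Rightarrow> nat \<Rightarrow> nat \<Rightarrow> real" where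
  "raise3 q f a b c = (1 - q ^ a) * f (a - 1) b c
     + q ^ a * ((1 - q ^ b) * f a (b - 1) c + q ^ b * (1 - q ^ c) * f a b (c - 1))"

definition lower3 :: "real \<Rightarrow> real \<Rightarrow> real \<Rightarrow> real \<Rightarrow> (nat \<Rightarrow> nat \<Rightarrow> nat \<Rightarrow> real) \<Rightarrow> nat \<Rightarrow> nat \<Rightarrow> nat \<Rightarrow> real" where
  "lower3 q A B C f a b c = (1 - A * q ^ a) * f (Suc a) b c
     + A * q ^ a * ((1 - B * q ^ b) * f a (Suc b) c + B * q ^ b * (1 - C * q ^ c) * f a b (Suc c))"

lemma raise3_sum:
  "raise3 q (\<lambda>a b c. \<Sum>y\<in>Y. r y * f y a b c) a b c = (\<Sum>y\<in>Y. r y * raise3 q (f y) a b c)"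
  unfolding raise3_def sum_distrib_left sum.distrib[symmetric]
  by (rule sum.cong) (simp_all add: algebra_simps)

lemma lower3_sum:
  "lower3 q A B C (\<lambda>a b c. \<Sum>y\<in>Y. r y * f y a b c) a b c = (\<Sum>y\<in>Y. r y * lower3 q A B C (f y) a b c)"
  unfolding lower3_def sum_distrib_left sum.distrib[symmetric]
  by (rule sum.cong) (simp_all add: algebra_simps)

context
  fixes q :: real
  assumes q0: "0 < q" and q1: "q < 1"
begin

lemma qpow_eq_1_iff: "q ^ k = 1 \<longleftrightarrow> k = 0"
  using power_eq_1_iff[of q k] q0 q1 by auto

lemma qpoch_q_nonzero [simp]: "qpoch q q k \<noteq> 0"
  by (rule qpoch_nonzero) (simp flip: power_Suc add: qpow_eq_1_iff)

lemma inverse_qpow_times_qpow: "j \<le> n \<Longrightarrow> inverse (q ^ n) * q ^ j = inverse (q ^ (n - j))"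
  using q0 by (simp add: power_diff field_simps)

lemma qpoch_inverse_qpow_eq_0: "n < k \<Longrightarrow> qpoch (inverse (q ^ n)) q k = 0"
  using q0 by (auto simp: qpoch_eq_0_iff intro!: exI[of _ n])

lemma qpoch_inverse_qpow_nonzero: "k \<le> n \<Longrightarrow> qpoch (inverse (q ^ n)) q k \<noteq> 0"
  by (rule qpoch_nonzero) (simp add: inverse_qpow_times_qpow qpow_eq_1_iff)

text \<open>Split (q^(-n-1);q)_(k+1) once at its first and once at its last factor, and multiply by
  -q^(n+1).\<close>

lemma qpoch_inverse_qpow_Suc:
  "(1 - q ^ Suc n) * qpoch (inverse (q ^ n)) q k
     = (q ^ k - q ^ Suc n) * qpoch (inverse (q ^ Suc n)) q k"
proof -
  define Q where "Q = q ^ Suc n"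
  have "Q \<noteq> 0" using q0 by (simp add: Q_def)
  moreover have "inverse Q * q = inverse (q ^ n)" using q0 by (simp add: Q_def)
  then have "(1 - inverse Q) * qpoch (inverse (q ^ n)) q k = qpoch (inverse Q) q k * (1 - inverse Q * q ^ k)"
    using qpoch_Suc_shift[of "inverse Q" q k] qpoch_Suc[of "inverse Q" q k] by simp
  ultimately show ?thesis
    unfolding Q_def[symmetric] by (simp add: field_simps)
qed

lemma hahn_eq_q_Hahn:
  assumes "n \<le> N" "x \<le> N"
  shows "q_Hahn n x (A / q) (B / q) N q = hahn q A B n x (N - x)"
proof -
  have "A / q * (B / q) * q ^ (n + 1) = A * B * q ^ n / q" for n
    using q0 by (simp add: field_simps)
  then show ?thesis
    using assms q0
    by (simp add: q_Hahn_def hahn_def hahn_norm_def hahn_sum_def hahn_coeff_def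
        power_int_minus atLeast0AtMost mult_ac)
qed

lemma hahn_norm_Suc:
  assumes "n \<le> N"
  shows "(1 - q ^ Suc N) * hahn_norm q n N = q ^ n * (1 - q ^ (Suc N - n)) * hahn_norm q n (Suc N)"
proof -
  have e: "q powr (- (real n * real N) + (real n)\<^sup>2 / 2)
      = q ^ n * q powr (- (real n * real (Suc N)) + (real n)\<^sup>2 / 2)"
    using q0 by (simp add: powr_realpow[symmetric] powr_add[symmetric] algebra_simps)
  have s: "Suc N - n = Suc (N - n)" using assms by simp
  have nz: "1 - q * q ^ (N - n) \<noteq> 0"
    by (simp flip: power_Suc add: qpow_eq_1_iff)
  show ?thesis
    unfolding hahn_norm_def e s qpoch_Suc
    using nz q0 by (simp add: field_simps)
qed

text \<open>In the k-th term the two parts contribute q^k - q^a and q^a - q^(a+b). Their sum q^k -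
  q^(a+b) depends on the total only and is absorbed by the denominator (q^(-N);q)_k. The parameters
  sit in coefficients free of a and b, hence drop out.\<close>

lemma hahn_raise:
  "(1 - q ^ a) * hahn q A B n (a - 1) b + q ^ a * (1 - q ^ b) * hahn q A B n a (b - 1)
       = q ^ n * (1 - q ^ (a + b - n)) * hahn q A B n a b"
proof (cases "a + b")
  case 0
  then show ?thesis by simp
next
  case N: (Suc N)
  show ?thesis
  proof (cases "n \<le> N")
    \<comment> \<open>Now n \<ge> a + b. The left side is 0 because the degree exceeds the reduced
      total; on the right either 1 - q^0 or \<open>hahn\<close> itself is 0.\<close>
    case False
    then show ?thesis using N by (cases a; cases b) (auto simp: hahn_def)
  next
    case True
    have each: "(1 - q ^ a) * (c * qpoch (inverse (q ^ (a - 1))) q k / qpoch (inverse (q ^ N)) q k)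
        + q ^ a * (1 - q ^ b) * (c * qpoch (inverse (q ^ a)) q k / qpoch (inverse (q ^ N)) q k)
      = (1 - q ^ Suc N) * (c * qpoch (inverse (q ^ a)) q k / qpoch (inverse (q ^ Suc N)) q k)"
      if "k \<le> n" for k c
    proof -
      define u v w where "u = qpoch (inverse (q ^ a)) q k" and "v = qpoch (inverse (q ^ N)) q k"
        and "w = qpoch (inverse (q ^ Suc N)) q k"
      have nz: "v \<noteq> 0" "w \<noteq> 0"
        using qpoch_inverse_qpow_nonzero that True by (auto simp: v_def w_def simp del: power_Suc)
      have 1: "(1 - q ^ a) * qpoch (inverse (q ^ (a - 1))) q k = (q ^ k - q ^ a) * u"
      proof (cases a)
        case 0
        then show ?thesis by (cases k) (auto simp: u_def qpoch_Suc_shift)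
      next
        case (Suc n)
        then show ?thesis using qpoch_inverse_qpow_Suc[of n k] by (simp add: u_def)
      qed
      have 2: "(1 - q ^ Suc N) * v = (q ^ k - q ^ Suc N) * w"
        unfolding v_def w_def by (rule qpoch_inverse_qpow_Suc)
      have 3: "q ^ a * q ^ b = q ^ Suc N" using N by (metis power_add)
      define r where "r = (1 - q ^ a) * qpoch (inverse (q ^ (a - 1))) q k + q ^ a * (1 - q ^ b) * u"
      have "r = (q ^ k - q ^ Suc N) * u"
        unfolding r_def 1 3[symmetric] by (simp add: algebra_simps)
      then have "r * w = (1 - q ^ Suc N) * u * v"
        using 2 by simp
      then have "r / v = (1 - q ^ Suc N) * u / w"
        using nz by (simp add: frac_eq_eq del: power_Suc)
      then have "c * (r / v) = c * ((1 - q ^ Suc N) * u / w)" by simp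
      moreover have "c * (r / v) = (1 - q ^ a) * (c * qpoch (inverse (q ^ (a - 1))) q k / v)
          + q ^ a * (1 - q ^ b) * (c * u / v)"
        by (simp add: r_def add_divide_distrib distrib_left mult_ac)
      ultimately show ?thesis
        unfolding u_def[symmetric] v_def[symmetric] w_def[symmetric] by (simp add: mult_ac)
    qed
    let ?s = "\<lambda>x. hahn_sum q n A (A * B) x"
    have sum: "(1 - q ^ a) * ?s (a - 1) N + q ^ a * (1 - q ^ b) * ?s a N = (1 - q ^ Suc N) * ?s a (Suc N)"
      unfolding hahn_sum_def sum_distrib_left sum.distrib[symmetric]
      by (rule sum.cong[OF refl], rule each) simp
    have ha: "(1 - q ^ a) * hahn q A B n (a - 1) b = (1 - q ^ a) * (hahn_norm q n N * ?s (a - 1) N)"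
      using N True by (cases a) (auto simp: hahn_def)
    have hb: "(1 - q ^ b) * hahn q A B n a (b - 1) = (1 - q ^ b) * (hahn_norm q n N * ?s a N)"
      using N True by (cases b) (auto simp: hahn_def)
    have "(1 - q ^ a) * hahn q A B n (a - 1) b + q ^ a * (1 - q ^ b) * hahn q A B n a (b - 1)
       = hahn_norm q n N * ((1 - q ^ a) * ?s (a - 1) N + q ^ a * (1 - q ^ b) * ?s a N)"
      by (simp only: ha hb mult.assoc) (simp add: algebra_simps)
    also have "\<dots> = ((1 - q ^ Suc N) * hahn_norm q n N) * ?s a (Suc N)"
      using sum by simp
    also have "\<dots> = q ^ n * (1 - q ^ (Suc N - n)) * (hahn_norm q n (Suc N) * ?s a (Suc N))"
      using hahn_norm_Suc[OF True] by simp
    also have "\<dots> = q ^ n * (1 - q ^ (Suc N - n)) * hahn q A B n a b"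
      using N True by (simp add: hahn_def)
    finally show ?thesis using N by simp
  qed
qed

text \<open>The limit c -> 0 of the terminating very-well-poised 6-phi-5 sum with a = P/q and b = E:
  the two factorials in the denominator form (P q^(z-1);q)_(m+1) without its factor 1 - P q^(2z-1),
  the very-well-poised one. The exponents 0, ..., 2m - 2 of the hypothesis are those occurring in
  the denominators.\<close>

lemma sum_shifted_products_eq_1:
  fixes E P :: real
  assumes "\<And>j. j + 2 \<le> 2 * m \<Longrightarrow> P * q ^ j \<noteq> 1"
  shows "(\<Sum>z\<le>m. qpoch q q m / (qpoch q q z * qpoch q q (m - z)) * qpoch E q z
            * (\<Prod>j=z..<m. E - P * q ^ j)
            / (qpoch (P * q ^ z / q) q z * qpoch (P * q ^ (2 * z)) q (m - z))) = 1"
  using assms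
proof (induction m)
  case (Suc m)
  define T where "T m z = qpoch q q m / (qpoch q q z * qpoch q q (m - z)) * qpoch E q z
            * (\<Prod>j=z..<m. E - P * q ^ j)
            / (qpoch (P * q ^ z / q) q z * qpoch (P * q ^ (2 * z)) q (m - z))" for m z
  define R where "R z = qpoch q q m / (qpoch q q z * qpoch q q (m - z)) * qpoch E q (Suc z)
            * (\<Prod>j=z..<m. E - P * q ^ j) / qpoch (P * q ^ z) q (Suc m)" for z
  \<comment> \<open>\<open>T\<close> is a WZ pair with \<open>R\<close>: \<open>T (m + 1) z - T m z = R (z - 1) - R z\<close>.\<close>
  have nzP: "1 - P * q ^ j \<noteq> 0" if "j \<le> 2 * m" for j
    using Suc.prems[of j] that by simp
  have partial: "(\<Sum>z\<le>Z. T (Suc m) z) = (\<Sum>z\<le>Z. T m z) - R Z" if "Z \<le> m" for Z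
    using that
  proof (induction Z)
    case 0
    define X where "X = (\<Prod>j<m. E - P * q ^ j)"
    define p where "p = qpoch P q m"
    define y where "y = P * q ^ m"
    have "1 - q * q ^ m \<noteq> 0"
      by (simp flip: power_Suc add: qpow_eq_1_iff)
    moreover have nz: "1 - y \<noteq> 0" "p \<noteq> 0"
      using nzP unfolding p_def y_def by (auto intro!: qpoch_nonzero)
    ultimately have "T (Suc m) 0 = X * (E - y) / (p * (1 - y))" "T m 0 = X / p"
      "R 0 = (1 - E) * X / (p * (1 - y))"
      by (simp_all add: T_def R_def qpoch_Suc X_def p_def y_def atLeast0LessThan)
    moreover have "X * (E - y) / (p * (1 - y)) = X / p - (1 - E) * X / (p * (1 - y))"
      using nz by (simp add: divide_simps) (simp add: algebra_simps)
    ultimately show ?case by simp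
  next
    case (Suc u)
    define z where "z = Suc u"
    define D where "D = qpoch (P * q ^ z) q u * qpoch (P * q ^ (2 * z)) q (m - z)"
    define X where "X = (\<Prod>j=z..<m. E - P * q ^ j)"
    obtain d where d: "m = z + d" using Suc.prems z_def le_Suc_ex by blast
    have pz: "P * q ^ z / q = P * q ^ u" using q0 by (simp add: z_def)
    have nz1: "qpoch (P * q ^ z) q u \<noteq> 0" 
    proof (rule qpoch_nonzero)
      fix j assume "j < u"
      then show "P * q ^ z * q ^ j \<noteq> 1"
        using nzP[of "z + j"] Suc.prems by (simp add: z_def power_add mult_ac)
    qed
    have nz2: "qpoch (P * q ^ (2 * z)) q d \<noteq> 0"
    proof (rule qpoch_nonzero)
      fix j assume "j < d"
      then show "P * q ^ (2 * z) * q ^ j \<noteq> 1"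
        using nzP[of "2 * z + j"] d by (simp add: power_add mult_ac)
    qed
    have nz3: "1 - P * q ^ u \<noteq> 0" "1 - P * q ^ (z + m) \<noteq> 0" "1 - P * q ^ (u + z) \<noteq> 0"
      using nzP[of u] nzP[of "z + m"] nzP[of "u + z"] Suc.prems by (simp_all add: z_def)
    have nz4: "1 - q * q ^ d \<noteq> 0" "1 - q ^ z \<noteq> 0"
      by (simp_all flip: power_Suc add: qpow_eq_1_iff z_def)
    have p1: "qpoch (P * q ^ z / q) q z = (1 - P * q ^ u) * qpoch (P * q ^ z) q u"
      unfolding pz unfolding z_def qpoch_Suc_shift by (simp add: mult_ac)
    have p2: "qpoch (P * q ^ (2 * z)) q (Suc d) = qpoch (P * q ^ (2 * z)) q d * (1 - P * q ^ (z + m))"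
    proof -
      have "P * q ^ (2 * z) * q ^ d = P * q ^ (z + m)"
        by (simp add: d mult_2 power_add mult.assoc)
      then show ?thesis by (simp add: qpoch_Suc)
    qed
    have p3: "qpoch (P * q ^ z) q m = qpoch (P * q ^ z) q u * (1 - P * q ^ (u + z)) * qpoch (P * q ^ (2 * z)) q d"
    proof -
      have "qpoch (P * q ^ z) q m = qpoch (P * q ^ z) q z * qpoch (P * q ^ z * q ^ z) q d"
        unfolding d by (rule qpoch_add)
      also have "qpoch (P * q ^ z) q z = qpoch (P * q ^ z) q u * (1 - P * q ^ (u + z))"
        unfolding z_def by (simp add: qpoch_Suc power_add mult_ac)
      also have "P * q ^ z * q ^ z = P * q ^ (2 * z)" by (simp add: mult_2 power_add)
      finally show ?thesis .
    qed
    have p4: "qpoch (P * q ^ z) q (Suc m) = qpoch (P * q ^ z) q m * (1 - P * q ^ (z + m))"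
      by (simp add: qpoch_Suc power_add mult_ac)
    have p5: "qpoch (P * q ^ u) q (Suc m) = (1 - P * q ^ u) * qpoch (P * q ^ z) q m"
      by (simp add: qpoch_Suc_shift z_def mult_ac)
    have x1: "(\<Prod>j=z..<Suc m. E - P * q ^ j) = X * (E - P * q ^ m)"
      using Suc.prems by (simp add: X_def z_def)
    have x2: "(\<Prod>j=u..<m. E - P * q ^ j) = (E - P * q ^ u) * X"
      using Suc.prems by (simp add: X_def z_def prod.atLeast_Suc_lessThan)
    have b1: "qpoch q q (Suc m) = qpoch q q m * (1 - q ^ Suc m)" "qpoch q q z = qpoch q q u * (1 - q ^ z)"
       "qpoch q q (Suc d) = qpoch q q d * (1 - q * q ^ d)"
      by (simp_all add: qpoch_Suc z_def)
    have e: "qpoch E q z = qpoch E q u * (1 - E * q ^ u)" "qpoch E q (Suc z) = qpoch E q z * (1 - E * q ^ z)"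
       by (simp_all add: qpoch_Suc z_def)
    have md: "Suc m - z = Suc d" "m - z = d" "m - u = Suc d" using d z_def by auto
    have pw: "q ^ z = q * q ^ u" "q ^ m = q * q ^ u * q ^ d" "q ^ (z + m) = q * q ^ u * (q * q ^ u * q ^ d)" 
       "q ^ (u + z) = q * q ^ u * q ^ u"
      by (simp_all add: z_def d power_add)
    \<comment> \<open>The factor shared by all four terms of the WZ relation. What remains of each
      is a product of three elementary factors, and the relation becomes the identity
      \<open>poly\<close>.\<close>
    define W where "W = qpoch q q m / (qpoch q q z * qpoch q q (Suc d)) * qpoch E q z * X 
        / ((1 - P * q ^ u) * qpoch (P * q ^ z) q m * (1 - P * q ^ (z + m)))"
    define f1 f2 f3 where "f1 = 1 - P * q ^ u" and "f2 = 1 - P * q ^ (z + m)" and "f3 = 1 - P * q ^ (u + z)"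
    define g1 g2 g3 where "g1 = 1 - q ^ Suc m" and "g2 = 1 - q * q ^ d" and "g3 = 1 - q ^ z"
    define h1 h2 h3 where "h1 = E - P * q ^ m" and "h2 = E - P * q ^ u" and "h3 = 1 - E * q ^ z"
    have poly: "g1 * h1 * f3 - g2 * f3 * f2 = g3 * h2 * f2 - g2 * h3 * f1"
      unfolding f1_def f2_def f3_def g1_def g2_def g3_def h1_def h2_def h3_def power_Suc pw by algebra
    note folds = f1_def[symmetric] f2_def[symmetric] f3_def[symmetric] g1_def[symmetric]
      g2_def[symmetric] g3_def[symmetric] h1_def[symmetric] h2_def[symmetric] h3_def[symmetric] X_def[symmetric]
    note nz = nz1 nz2 nz3[unfolded folds] nz4[unfolded folds]
    have "T (Suc m) z = W * (g1 * h1 * f3)"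
      unfolding T_def W_def md p1 p2 p3 x1 b1(1) folds using nz by (simp add: field_simps)
    moreover have "T m z = W * (g2 * f3 * f2)"
      unfolding T_def W_def md p1 p2 p3 b1(3) folds using nz by (simp add: field_simps)
    moreover have "R z = W * (g2 * h3 * f1)"
      unfolding R_def W_def md p4 p3 b1(3) e(2) folds using nz by (simp add: field_simps)
    moreover have "R u = W * (g3 * h2 * f2)"
      unfolding R_def W_def md p5 p3 x2 b1(2) z_def[symmetric] folds using nz by (simp add: field_simps)
    ultimately have "T (Suc m) z - T m z = R u - R z"
      using poly by (simp flip: right_diff_distrib)
    then show ?case using Suc by (simp add: z_def)
  qed
  have "(\<Sum>z\<le>m. T m z) = 1"
    unfolding T_def using Suc by simp
  \<comment> \<open>The sum for m + 1 has one term more than the sum for m; it cancels the boundary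
    term R m.\<close>
  moreover have "T (Suc m) (Suc m) = R m"
  proof -
    have 1: "P * q ^ Suc m / q = P * q ^ m" using q0 by simp
    show ?thesis
      unfolding T_def R_def 1 by (simp)
  qed
  ultimately have "(\<Sum>z\<le>Suc m. T (Suc m) z) = 1"
    using partial[of m] by simp
  then show ?case by (simp add: T_def)
qed simp

text \<open>Creative telescoping: the combination of k-th terms is \<mu> times a k-th term plus U (k
  + 1) - U k, and U vanishes at 0 and at n + 1. For n = N + 1 the sum on the right has a zero
  denominator, but there \<mu> = 0.\<close>

lemma hahn_lower_sum:
  assumes n: "n \<le> Suc (a + b)" and A: "\<And>j. j < n \<Longrightarrow> A * q ^ j \<noteq> 1"
  defines "N \<equiv> a + b"
  shows "(1 - A * q ^ a) * hahn_sum q n A (A * B) (Suc a) (Suc N)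
       + A * q ^ a * (1 - B * q ^ b) * hahn_sum q n A (A * B) a (Suc N)
     = (q ^ n - q ^ Suc N) * (1 - A * B * q ^ (n + N)) / (q ^ n * (1 - q ^ Suc N))
       * hahn_sum q n A (A * B) a N"
proof -
  define Q where "Q = q ^ Suc N"
  define \<mu> where "\<mu> = (q ^ n - Q) * (1 - A * B * q ^ (n + N)) / (q ^ n * (1 - Q))"
  define t where "t = hahn_coeff q n A (A * B)"
  define u where "u = qpoch (inverse (q ^ a)) q"
  define u' where "u' = qpoch (inverse (q ^ Suc a)) q"
  define v where "v = qpoch (inverse (q ^ N)) q"
  define v' where "v' = qpoch (inverse (q ^ Suc N)) q"
  \<comment> \<open>V k is U (k + 1). By the recursion for t it can be rewritten through t (k + 1),
    so U k and U (k + 1) both become multiples of t k.\<close>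
  define V where "V k = t k * (1 - q ^ k / q ^ n) * (1 - A * B * q ^ n * q ^ k / q) / q ^ k * u k / v' (Suc k)"
    for k
  define U where "U k = (case k of 0 \<Rightarrow> 0 | Suc k' \<Rightarrow> V k')" for k
  have Q1: "Q \<noteq> 1" unfolding Q_def using qpow_eq_1_iff by blast
  have Q0: "Q \<noteq> 0" using q0 by (simp add: Q_def)
  have QXY: "Q = q * q ^ a * q ^ b" by (simp add: Q_def N_def power_add)
  have qN: "q ^ (n + N) = q ^ n * q ^ a * q ^ b" by (simp add: N_def power_add)
  have v': "v' (Suc k) = v' k * (1 - q ^ k / Q)" for k
    by (simp add: v'_def qpoch_Suc Q_def divide_inverse mult_ac)
  have v: "v' (Suc k) = (1 - 1 / Q) * v k" for k
  proof -
    have "inverse (q ^ Suc N) * q = inverse (q ^ N)" using q0 by simp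
    then show ?thesis
      using qpoch_Suc_shift[of "inverse (q ^ Suc N)" q k]
      unfolding v_def v'_def Q_def by (simp add: divide_inverse del: power_Suc)
  qed
  have each: "(1 - A * q ^ a) * (t k * u' k / v' k) + A * q ^ a * (1 - B * q ^ b) * (t k * u k / v' k)
      = \<mu> * (t k * u k / v k) + (U (Suc k) - U k)" if k: "k \<le> n" for k
  proof (cases k)
    case 0
    have Y: "q ^ a \<noteq> 0" "q ^ b \<noteq> 0" "q ^ n \<noteq> 0" "q \<noteq> 0" using q0 by auto
    have "1 - A * B * q ^ a * q ^ b = \<mu> + (1 - 1 / q ^ n) * (1 - A * B * q ^ n / q) / (1 - 1 / Q)"
      using hahn_lower_key_0[OF Y(4,1,2,3) QXY Q1, of A B] by (simp add: \<mu>_def qN mult_ac)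
    moreover have "t 0 = 1" "u 0 = 1" "u' 0 = 1" "v 0 = 1" "v' 0 = 1"
      by (simp_all add: t_def u_def u'_def v_def v'_def hahn_coeff_def)
    moreover have "U (Suc 0) = (1 - 1 / q ^ n) * (1 - A * B * q ^ n / q) / (1 - 1 / Q)"
      unfolding U_def V_def by (simp add: v' calculation)
    moreover have "(1 - A * q ^ a) + A * q ^ a * (1 - B * q ^ b) = 1 - A * B * q ^ a * q ^ b"
      by (simp add: algebra_simps)
    ultimately show ?thesis
      unfolding 0 by (simp add: U_def)
  next
    case (Suc k')
    define \<kappa> where "\<kappa> = q ^ k"
    have \<kappa>: "q ^ k' = \<kappa> / q" using q0 by (simp add: \<kappa>_def Suc)
    have nz: "q \<noteq> 0" "q ^ a \<noteq> 0" "q ^ b \<noteq> 0" "\<kappa> \<noteq> 0" "q ^ n \<noteq> 0" using q0 by (auto simp: \<kappa>_def)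
    have "\<kappa> \<noteq> 1"
      unfolding \<kappa>_def using qpow_eq_1_iff[of k] Suc by simp
    moreover have "A * (\<kappa> / q) \<noteq> 1"
      unfolding \<kappa>[symmetric] using A[of k'] k Suc by simp
    ultimately have \<kappa>1: "1 - \<kappa> \<noteq> 0" "1 - A * \<kappa> / q \<noteq> 0"
      by simp_all
    have tk: "t k * ((1 - A * \<kappa> / q) * (1 - \<kappa>)) = t k' * (q * (1 - q ^ k' / q ^ n) * (1 - A * B * q ^ n * q ^ k' / q))"
      (is "_ * ?d = _")
    proof -
      have d: "?d = (1 - A * q ^ k') * (1 - q * q ^ k')"
        unfolding \<kappa> using nz by simp
      have "t k = t k' * (q * (1 - q ^ k' / q ^ n) * (1 - A * B * q ^ n * q ^ k' / q)) / ?d"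
        unfolding d t_def hahn_coeff_def Suc qpoch_Suc
        by (simp add: divide_inverse mult_ac)
      then show ?thesis using \<kappa>1 by simp
    qed
    have uk: "u k = u k' * (1 - \<kappa> / (q * q ^ a))"
      by (simp add: u_def Suc qpoch_Suc \<kappa> divide_inverse mult_ac)
    have u'k: "u' k = (1 - 1 / (q * q ^ a)) * u k'"
    proof -
      have "inverse (q ^ Suc a) * q = inverse (q ^ a)" using q0 by simp
      then have "u' k = (1 - 1 / q ^ Suc a) * u k'"
        using qpoch_Suc_shift[of "inverse (q ^ Suc a)" q k']
        unfolding u_def u'_def Suc by (simp add: divide_inverse del: power_Suc)
      then show ?thesis by simp
    qed
    have Uk: "U k = t k * ((1 - A * \<kappa> / q) * (1 - \<kappa>)) / \<kappa> * u k' / v' k"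
      unfolding tk unfolding Suc U_def V_def \<kappa> using nz Suc by (simp add: \<kappa>_def)
    have USk: "U (Suc k) = t k * (1 - \<kappa> / q ^ n) * (1 - A * B * q ^ n * \<kappa> / q) / \<kappa> * u k / v' (Suc k)"
      by (simp add: U_def V_def \<kappa>_def)
    show ?thesis
    proof (cases "k \<le> N")
      case True
      have v0: "v' k \<noteq> 0" "v k \<noteq> 0"
        using True qpoch_inverse_qpow_nonzero by (auto simp: v_def v'_def simp del: power_Suc)
      have Q2: "1 - 1 / Q \<noteq> 0" using Q1 Q0 by (simp add: field_simps)
      have rel: "v' k * (1 - \<kappa> / Q) = (1 - 1 / Q) * v k"
        unfolding v[symmetric] v' \<kappa>_def ..
      then have "v' k * (1 - \<kappa> / Q) \<noteq> 0" using Q2 v0 by (metis mult_eq_0_iff)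
      then have kQ: "1 - \<kappa> / Q \<noteq> 0" by (metis mult_zero_right)
      have vk: "1 / v k = (1 - 1 / Q) / (v' k * (1 - \<kappa> / Q))"
        unfolding rel using Q2 by simp
      define L1 L2 L3 L4 where "L1 = (1 - A * q ^ a) * (1 - 1 / (q * q ^ a)) + A * q ^ a * (1 - B * q ^ b) * (1 - \<kappa> / (q * q ^ a))"
        and "L2 = \<mu> * (1 - 1 / Q) * (1 - \<kappa> / (q * q ^ a))" and
        "L3 = (1 - \<kappa> / q ^ n) * (1 - A * B * q ^ n * \<kappa> / q) / \<kappa> * (1 - \<kappa> / (q * q ^ a))"
        and "L4 = (1 - A * \<kappa> / q) * (1 - \<kappa>) / \<kappa>"
      have key: "L1 * (1 - \<kappa> / Q) = L2 + L3 - L4 * (1 - \<kappa> / Q)"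
        unfolding L1_def L2_def L3_def L4_def
        using hahn_lower_key[of q "q ^ a" "q ^ b" \<kappa> "q ^ n" Q A B] nz QXY Q1
        by (simp add: \<mu>_def qN mult_ac)
      then have "L1 = (L2 + L3) / (1 - \<kappa> / Q) - L4"
        using kQ by (simp add: field_simps)
      then have "t k * u k' / v' k * L1 = t k * u k' / v' k * ((L2 + L3) / (1 - \<kappa> / Q) - L4)" by simp
      moreover have "(1 - A * q ^ a) * (t k * u' k / v' k) + A * q ^ a * (1 - B * q ^ b) * (t k * u k / v' k)
          = t k * u k' / v' k * L1"
        unfolding u'k uk L1_def distrib_left by (simp add: mult_ac)
      moreover have "\<mu> * (t k * u k / v k) = t k * u k' / v' k * (L2 / (1 - \<kappa> / Q))"
      proof -
        have "\<mu> * (t k * u k / v k) = \<mu> * t k * u k * (1 / v k)" by simp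
        also have "\<dots> = t k * u k' / v' k * (L2 / (1 - \<kappa> / Q))"
          unfolding vk uk L2_def by simp
        finally show ?thesis .
      qed
      moreover have "U (Suc k) = t k * u k' / v' k * (L3 / (1 - \<kappa> / Q))"
        unfolding USk uk v' L3_def \<kappa>_def by (simp add: mult_ac)
      moreover have "U k = t k * u k' / v' k * L4"
        unfolding Uk L4_def by (simp add: mult_ac)
      ultimately show ?thesis by (simp add: right_diff_distrib add_divide_distrib distrib_left)
    next
      \<comment> \<open>Only k = n = N + 1 is left. Then \<mu>, u k and U (k + 1) are 0, and the
        term with u' k has to cancel U k.\<close>
      case False
      then have kN: "k = Suc N" "n = Suc N" using k n by (auto simp: N_def)
      have "\<mu> = 0" by (simp add: \<mu>_def kN Q_def)
      moreover have "U (Suc k) = 0" using q0 by (simp add: U_def V_def kN)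
      moreover have u0: "u k = 0"
        unfolding u_def by (rule qpoch_inverse_qpow_eq_0) (simp add: kN N_def)
      \<comment> \<open>Since u k = 0, either u k' = 0 already or its last factor vanishes, that is,
        \<kappa> = q^(a+1).\<close>
      moreover have "(1 - A * q ^ a) * u' k = - ((1 - A * \<kappa> / q) * (1 - \<kappa>)) / \<kappa> * u k'"
      proof (cases "u k' = 0")
        case False
        then have "\<kappa> = q * q ^ a" using u0 uk nz by (simp add: field_simps)
        then show ?thesis unfolding u'k using nz by (simp add: field_simps)
      qed (simp add: u'k)
      then have "t k / v' k * ((1 - A * q ^ a) * u' k) = - U k"
        unfolding Uk by (simp add: mult.commute mult.left_commute)
      then have "(1 - A * q ^ a) * (t k * u' k / v' k) = - U k"
        by (simp add: mult_ac)
      ultimately show ?thesis by simp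
    qed
  qed
  have "(\<Sum>k\<le>m. U (Suc k) - U k) = U (Suc m) - U 0" for m
    by (induction m) simp_all
  moreover have "U (Suc n) = 0" "U 0 = 0" using q0 by (simp_all add: U_def V_def)
  ultimately have tel: "(\<Sum>k\<le>n. U (Suc k) - U k) = 0" by simp
  have "(1 - A * q ^ a) * hahn_sum q n A (A * B) (Suc a) (Suc N)
       + A * q ^ a * (1 - B * q ^ b) * hahn_sum q n A (A * B) a (Suc N)
     = (\<Sum>k\<le>n. (1 - A * q ^ a) * (t k * u' k / v' k) + A * q ^ a * (1 - B * q ^ b) * (t k * u k / v' k))"
    unfolding hahn_sum_def sum_distrib_left sum.distrib[symmetric] t_def u_def u'_def v'_def ..
  also have "\<dots> = (\<Sum>k\<le>n. \<mu> * (t k * u k / v k) + (U (Suc k) - U k))"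
    by (rule sum.cong[OF refl], rule each) simp
  also have "\<dots> = \<mu> * hahn_sum q n A (A * B) a N"
    unfolding sum.distrib tel hahn_sum_def sum_distrib_left t_def u_def v_def by simp
  finally show ?thesis unfolding \<mu>_def Q_def .
qed

text \<open>The case n = a + b + 1, with right side 0, is the recursion behind
  \<open>hahn_top_degree\<close> and behind the vanishing in the two \<open>lower3\<close> lemmas on
  nested polynomials.\<close>

lemma hahn_lower:
  assumes A: "\<And>j. j < n \<Longrightarrow> A * q ^ j \<noteq> 1"
  shows "(1 - A * q ^ a) * hahn q A B n (Suc a) b + A * q ^ a * (1 - B * q ^ b) * hahn q A B n a (Suc b)
       = (1 - A * B * q ^ (n + a + b)) / q ^ n * hahn q A B n a b"
proof (cases "n \<le> Suc (a + b)")
  case False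
  then show ?thesis by (simp add: hahn_def)
next
  case True
  let ?s = "\<lambda>x N. hahn_sum q n A (A * B) x N"
  let ?N = "a + b"
  have "(1 - A * q ^ a) * hahn q A B n (Suc a) b + A * q ^ a * (1 - B * q ^ b) * hahn q A B n a (Suc b)
    = hahn_norm q n (Suc ?N) * ((1 - A * q ^ a) * ?s (Suc a) (Suc ?N) + A * q ^ a * (1 - B * q ^ b) * ?s a (Suc ?N))"
    using True by (simp add: hahn_def algebra_simps)
  also have "\<dots> = hahn_norm q n (Suc ?N) * ((q ^ n - q ^ Suc ?N) * (1 - A * B * q ^ (n + ?N)) / (q ^ n * (1 - q ^ Suc ?N)) * ?s a ?N)"
    using hahn_lower_sum[OF True A, of B] by simp
  also have "\<dots> = (1 - A * B * q ^ (n + a + b)) / q ^ n * hahn q A B n a b"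
  proof (cases "n \<le> ?N")
    case le: True
    have "1 - q ^ Suc ?N \<noteq> 0" using qpow_eq_1_iff[of "Suc ?N"] by auto
    moreover have "q ^ n * (1 - q ^ (Suc ?N - n)) = q ^ n - q ^ Suc ?N"
      using le by (simp add: right_diff_distrib flip: power_add power_Suc)
    ultimately have "hahn_norm q n ?N = (q ^ n - q ^ Suc ?N) / (1 - q ^ Suc ?N) * hahn_norm q n (Suc ?N)"
      using hahn_norm_Suc[OF le] by (simp add: field_simps)
    then show ?thesis using le by (simp add: hahn_def add.assoc)
  next
    case False
    then have "n = Suc ?N" using True by simp
    then show ?thesis by (simp add: hahn_def)
  qed
  finally show ?thesis .
qed

lemma hahn_sum_0: "hahn_sum q n A P 0 N = 1"
proof -
  have "qpoch 1 q k = 0" if "k \<noteq> 0" for k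
    using that by (auto simp: qpoch_eq_0_iff)
  then have "hahn_sum q n A P 0 N = (\<Sum>k\<in>{0}. hahn_coeff q n A P k * qpoch 1 q k / qpoch (inverse (q ^ N)) q k)"
    unfolding hahn_sum_def by (intro sum.mono_neutral_cong_right) auto
  then show ?thesis by (simp add: hahn_coeff_def)
qed

text \<open>At total N - 1 the right side of \<open>hahn_lower\<close> is 0, so consecutive values
  have an explicit ratio; the start is \<open>hahn_sum_0\<close>.\<close>

lemma hahn_top_degree:
  assumes A: "\<And>j. j < N \<Longrightarrow> A * q ^ j \<noteq> 1" and "x \<le> N"
  shows "qpoch A q x * hahn q A B N x (N - x)
       = hahn_norm q N N * (\<Prod>j<x. - (A * q ^ j * (1 - B * q ^ (N - Suc j))))"
  using \<open>x \<le> N\<close>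
proof (induction x)
  case 0
  then show ?case by (simp add: hahn_def hahn_sum_0)
next
  case (Suc x)
  define b where "b = N - Suc x"
  have b: "N - x = Suc b" using Suc.prems by (simp add: b_def)
  have "x + b < N" using Suc.prems by (simp add: b_def)
  then have "hahn q A B N x b = 0" by (simp add: hahn_def)
  then have "(1 - A * q ^ x) * hahn q A B N (Suc x) b = - (A * q ^ x * (1 - B * q ^ b)) * hahn q A B N x (Suc b)"
    using hahn_lower[OF A, where n = N and B = B and a = x and b = b] by simp
  then have "qpoch A q (Suc x) * hahn q A B N (Suc x) b 
     = - (A * q ^ x * (1 - B * q ^ b)) * (qpoch A q x * hahn q A B N x (Suc b))"
    by (simp add: qpoch_Suc mult_ac)
  also have "qpoch A q x * hahn q A B N x (Suc b) = hahn_norm q N N * (\<Prod>j<x. - (A * q ^ j * (1 - B * q ^ (N - Suc j))))"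
    using Suc b by simp
  finally show ?case by (simp add: b_def)
qed

section \<open>The connection formula on three boxes\<close>

lemma qpoch_inverse_qpow_add:
  "qpoch (inverse (q ^ (k + z))) q k * q ^ (z * k) * qpoch q q z * qpoch q q k
     = qpoch (inverse (q ^ k)) q k * qpoch q q (k + z)"
proof (induction z)
  case (Suc z)
  define n where "n = k + z"
  have 1: "(1 - q ^ Suc n) * qpoch (inverse (q ^ n)) q k
     = q ^ k * (1 - q ^ Suc z) * qpoch (inverse (q ^ Suc n)) q k"
    using qpoch_inverse_qpow_Suc[of n k]
    by (simp add: n_def power_add algebra_simps)
  have "qpoch (inverse (q ^ (k + Suc z))) q k * q ^ (Suc z * k) * qpoch q q (Suc z) * qpoch q q k
     = (q ^ k * (1 - q ^ Suc z) * qpoch (inverse (q ^ Suc n)) q k) * (q ^ (z * k) * qpoch q q z * qpoch q q k)"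
    by (simp add: n_def power_add qpoch_Suc mult_ac)
  also have "\<dots> = (1 - q ^ Suc n) * (qpoch (inverse (q ^ n)) q k * q ^ (z * k) * qpoch q q z * qpoch q q k)"
    unfolding 1[symmetric] by simp
  also have "\<dots> = (1 - q ^ Suc n) * (qpoch (inverse (q ^ k)) q k * qpoch q q n)"
    using Suc by (simp add: n_def)
  also have "\<dots> = qpoch (inverse (q ^ k)) q k * qpoch q q (k + Suc z)"
    by (simp add: n_def qpoch_Suc mult_ac)
  finally show ?case .
qed simp

text \<open>The additional factor is the y-dependent part of the k-th q-Racah term. It removes all y
  < k, and y = k + z turns the rest into \<open>sum_shifted_products_eq_1\<close> with m = b - k, E
  q^k and P q^(2k).\<close>

lemma sum_shifted_products_eq_qpoch:
  fixes E P :: real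
  assumes P: "\<And>j. j + 2 \<le> 2 * b \<Longrightarrow> P * q ^ j \<noteq> 1" and E: "qpoch E q k \<noteq> 0"
  shows "(\<Sum>y\<le>b. qpoch q q b / (qpoch q q y * qpoch q q (b - y)) * qpoch E q y
            * (\<Prod>j=y..<b. E - P * q ^ j)
            / (qpoch (P * q ^ y / q) q y * qpoch (P * q ^ (2 * y)) q (b - y))
            * (qpoch (inverse (q ^ y)) q k * qpoch (P * q ^ y / q) q k / qpoch E q k))
         = qpoch (inverse (q ^ b)) q k" (is "(\<Sum>y\<le>b. ?f y) = _")
proof (cases "b < k")
  case True
  then have "?f y = 0" if "y \<le> b" for y
    using that qpoch_inverse_qpow_eq_0[of y k] by simp
  then show ?thesis
    using qpoch_inverse_qpow_eq_0[OF True] by (simp add: sum.neutral)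
next
  case False
  then obtain m where b: "b = k + m" using le_Suc_ex not_less by blast
  have "(\<Sum>y\<le>b. ?f y) = (\<Sum>z\<le>m. ?f (k + z))"
    unfolding b by (rule sum_atMost_add_drop) (simp add: qpoch_inverse_qpow_eq_0)
  also have "\<dots> = (\<Sum>z\<le>m. qpoch (inverse (q ^ b)) q k *
     (qpoch q q m / (qpoch q q z * qpoch q q (m - z)) * qpoch (E * q ^ k) q z
            * (\<Prod>j=z..<m. E * q ^ k - P * q ^ (2 * k) * q ^ j)
            / (qpoch (P * q ^ (2 * k) * q ^ z / q) q z * qpoch (P * q ^ (2 * k) * q ^ (2 * z)) q (m - z))))"
  proof (rule sum.cong[OF refl])
    fix z assume "z \<in> {..m}"
    then obtain d where m: "m = z + d" using le_Suc_ex by auto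
    define F where "F = (\<Prod>j=k + z..<b. E - P * q ^ j)"
    define G where "G = (\<Prod>j=z..<m. E * q ^ k - P * q ^ (2 * k) * q ^ j)"
    define c where "c = qpoch (P * q ^ (k + z) / q) q k"
    have G: "G = q ^ (d * k) * F"
    proof -
      have "F = (\<Prod>j=z..<m. E - P * q ^ (j + k))"
        unfolding F_def b by (subst add.commute, subst (2) add.commute) (rule prod.shift_bounds_nat_ivl)
      moreover have "q ^ (d * k) = (\<Prod>j=z..<m. q ^ k)"
        by (simp add: m flip: power_mult) (simp add: mult.commute)
      ultimately have "q ^ (d * k) * F = (\<Prod>j=z..<m. q ^ k * (E - P * q ^ (j + k)))"
        by (simp only: prod.distrib)
      moreover have "q ^ (2 * k) = q ^ k * q ^ k" by (simp add: mult_2 power_add)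
      ultimately show ?thesis
        unfolding G_def by (simp only:) (simp add: power_add algebra_simps)
    qed
    have c0: "c \<noteq> 0"
    proof (cases k)
      case (Suc k')
      have "P * q ^ (k' + z) * q ^ j \<noteq> 1" if "j < k" for j
        using P[of "k' + z + j"] that Suc b m by (simp add: power_add mult_ac)
      moreover have "P * q ^ (k + z) / q = P * q ^ (k' + z)" using q0 Suc by simp
      ultimately show ?thesis unfolding c_def by (intro qpoch_nonzero) simp
    qed (simp add: c_def)
    have 1: "qpoch (P * q ^ (k + z) / q) q (k + z) = c * qpoch (P * q ^ (2 * k) * q ^ z / q) q z"
    proof -
      have "P * q ^ (k + z) / q * q ^ k = P * q ^ (2 * k) * q ^ z / q"
        by (simp add: power_add mult_2)
      then show ?thesis by (simp only: qpoch_add[of _ q k z] c_def)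
    qed
    have 2: "qpoch E q (k + z) = qpoch E q k * qpoch (E * q ^ k) q z" by (rule qpoch_add)
    have 3: "P * q ^ (2 * (k + z)) = P * q ^ (2 * k) * q ^ (2 * z)"
      by (simp add: power_add distrib_left)
    have 4: "b - (k + z) = m - z" using b by simp
    \<comment> \<open>Both (q^(-y);q)_k with y = k + z and (q^(-b);q)_k are compared with
      (q^(-k);q)_k, so the sign and the quadratic power of q from reversing such products never
      appear.\<close>
    have 5: "qpoch q q b / (qpoch q q (k + z) * qpoch q q (m - z)) * qpoch (inverse (q ^ (k + z))) q k
       = q ^ (d * k) * (qpoch q q m / (qpoch q q z * qpoch q q (m - z))) * qpoch (inverse (q ^ b)) q k"
    proof -
      let ?g = "qpoch q q"
      have [simp]: "?g n \<noteq> 0" for n by (rule qpoch_q_nonzero)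
      let ?i = "qpoch (inverse (q ^ k)) q k"
      have qq: "q \<noteq> 0" using q0 by simp
      have i1: "qpoch (inverse (q ^ (k + z))) q k = ?i * ?g (k + z) / (q ^ (z * k) * ?g z * ?g k)"
        using qpoch_inverse_qpow_add[of k z] qq by (simp add: field_simps)
      have i2: "qpoch (inverse (q ^ b)) q k = ?i * ?g b / (q ^ (m * k) * ?g m * ?g k)"
        using qpoch_inverse_qpow_add[of k m] qq unfolding b by (simp add: field_simps)
      have i3: "q ^ (m * k) = q ^ (d * k) * q ^ (z * k)" by (simp add: m distrib_right power_add)
      show ?thesis unfolding i1 i2 i3 using qq by (simp add: field_simps)
    qed
    have "?f (k + z) = (qpoch q q b / (qpoch q q (k + z) * qpoch q q (m - z)) * qpoch (inverse (q ^ (k + z))) q k)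
       * qpoch (E * q ^ k) q z * F / (qpoch (P * q ^ (2 * k) * q ^ z / q) q z * qpoch (P * q ^ (2 * k) * q ^ (2 * z)) q (m - z))"
      unfolding 1 2 3 4 F_def[symmetric] c_def[symmetric] using c0 E by simp (simp only: mult_ac)
    also have "\<dots> = qpoch (inverse (q ^ b)) q k * (qpoch q q m / (qpoch q q z * qpoch q q (m - z)) * qpoch (E * q ^ k) q z * G
            / (qpoch (P * q ^ (2 * k) * q ^ z / q) q z * qpoch (P * q ^ (2 * k) * q ^ (2 * z)) q (m - z)))"
      unfolding 5 G by (simp add: mult.left_commute)
    finally show "?f (k + z) = \<dots>" unfolding G_def .
  qed
  also have "\<dots> = qpoch (inverse (q ^ b)) q k"
    unfolding sum_distrib_left[symmetric]
  proof (subst sum_shifted_products_eq_1)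
    fix j assume "j + 2 \<le> 2 * m"
    then show "P * q ^ (2 * k) * q ^ j \<noteq> 1"
      using P[of "2 * k + j"] b by (simp add: power_add mult.assoc)
  qed simp
  finally show ?thesis .
qed

text \<open>With these parameters \<delta> q^(w-M) becomes B C q^(w-1), so the w-dependent part of
  the summand is the coefficient of \<open>hahn q B C w\<close>. This separates w from y.\<close>

lemma q_Racah_eq:
  fixes A B C :: real
  assumes "y \<le> M"
  defines "E \<equiv> A * B * C * q ^ M / q"
  shows "q_Racah y w (B / q) (A / q) (B * C * q ^ M / q) M q
    = qpoch E q y * qpoch (q ^ Suc (M - y)) q y
        / (q ^ (y * (M - y)) * (qpoch (A * B * q ^ y / q) q y * qpoch q q y))
      * (\<Sum>k\<le>y. hahn_coeff q w B (B * C) k / qpoch (inverse (q ^ M)) q k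
          * (qpoch (inverse (q ^ y)) q k * qpoch (A * B * q ^ y / q) q k / qpoch E q k))"
proof -
  have p1: "q powi (int M - int y + 1) = q ^ Suc (M - y)"
  proof -
    have "int M - int y + 1 = int (Suc (M - y))" using assms by simp
    then show ?thesis by (simp only: power_int_of_nat)
  qed
  have p2: "q powi (int y * (int M - int y)) = q ^ (y * (M - y))"
  proof -
    have "int y * (int M - int y) = int (y * (M - y))" using assms by simp
    then show ?thesis by (simp only: power_int_of_nat)
  qed
  have p3: "B * C * q ^ M / q * q powi (int w - int M) = B * C * q ^ w / q"
    using q0 by (simp add: power_int_diff)
  have p4: "B / q * (A / q) * q ^ (y + 1) = A * B * q ^ y / q"
    using q0 by (simp add: field_simps)
  have p5: "A / q * (B * C * q ^ M / q) * q = E" "B / q * q = B"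
    using q0 by (simp_all add: E_def)
  show ?thesis
    unfolding q_Racah_def p1 p2 p3 p4 p5 power_int_minus power_int_of_nat hahn_coeff_def atLeast0AtMost
    by (rule arg_cong2[where f = "(*)"], simp add: divide_inverse mult_ac, rule sum.cong[OF refl])
      (simp add: divide_inverse mult_ac)
qed

text \<open>The exponents satisfy -(M-y)^2/2 + y^2/2 - y b = -M^2/2 + y (M-b), so y contributes an
  integral power only.\<close>

lemma hahn_norm_mult:
  assumes "y \<le> b" "b \<le> M"
  shows "hahn_norm q (M - y) (M - y) * hahn_norm q y b
       = hahn_norm q M M * q ^ (y * (M - b)) * (qpoch q q (M - y) * qpoch q q b / (qpoch q q (b - y) * qpoch q q M))"
proof -
  let ?e = "\<lambda>n N. - (real n * real N) + (real n)\<^sup>2 / 2"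
  have "?e (M - y) (M - y) + ?e y b = ?e M M + real (y * (M - b))"
    using assms by (simp add: of_nat_diff power2_eq_square field_simps)
  then have "q powr ?e (M - y) (M - y) * q powr ?e y b = q powr ?e M M * q ^ (y * (M - b))"
    using q0 by (simp only: powr_realpow[symmetric] powr_add[symmetric])
  moreover have "qpoch q q M \<noteq> 0" by (rule qpoch_q_nonzero)
  ultimately show ?thesis
    unfolding hahn_norm_def by (simp add: mult_ac)
qed

text \<open>Each factor -P q^(2y+j) (1 - C q^(M-y-1-j)) equals q^y (E - P q^(y+j)), the form that
  \<open>sum_shifted_products_eq_1\<close> asks for.\<close>

lemma hahn_top_degree_product:
  fixes P C :: real
  assumes P: "\<And>j. j + 2 \<le> 2 * M \<Longrightarrow> P * q ^ j \<noteq> 1" and y: "y \<le> b" "b \<le> M"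
  defines "E \<equiv> P * C * q ^ M / q"
  shows "hahn q (P * q ^ (2 * y)) C (M - y) (b - y) (M - b)
    = hahn_norm q (M - y) (M - y) * q ^ (y * (b - y)) * (\<Prod>j=y..<b. E - P * q ^ j)
      / qpoch (P * q ^ (2 * y)) q (b - y)"
proof -
  have nz: "P * q ^ (2 * y) * q ^ j \<noteq> 1" if "j < M - y" for j
    using P[of "2 * y + j"] that y by (simp add: power_add mult.assoc)
  then have "qpoch (P * q ^ (2 * y)) q (b - y) * hahn q (P * q ^ (2 * y)) C (M - y) (b - y) (M - y - (b - y))
     = hahn_norm q (M - y) (M - y) * (\<Prod>j<b - y. - (P * q ^ (2 * y) * q ^ j * (1 - C * q ^ (M - y - Suc j))))"
    using y by (intro hahn_top_degree) auto
  moreover have "qpoch (P * q ^ (2 * y)) q (b - y) \<noteq> 0"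
    using nz y by (intro qpoch_nonzero) auto
  moreover have "M - y - (b - y) = M - b" using y by simp
  moreover have "(\<Prod>j<b - y. - (P * q ^ (2 * y) * q ^ j * (1 - C * q ^ (M - y - Suc j))))
     = q ^ (y * (b - y)) * (\<Prod>j=y..<b. E - P * q ^ j)"
  proof -
    have "(\<Prod>j=y..<b. E - P * q ^ j) = (\<Prod>j<b - y. E - P * q ^ (j + y))"
      using prod.shift_bounds_nat_ivl[of "\<lambda>j. E - P * q ^ j" 0 y "b - y"] y
      by (simp add: atLeast0LessThan)
    moreover have "q ^ (y * (b - y)) = (\<Prod>j<b - y. q ^ y)"
      by (simp add: power_mult)
    ultimately have "q ^ (y * (b - y)) * (\<Prod>j=y..<b. E - P * q ^ j) = (\<Prod>j<b - y. q ^ y * (E - P * q ^ (j + y)))"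
      by (simp only: prod.distrib)
    also have "\<dots> = (\<Prod>j<b - y. - (P * q ^ (2 * y) * q ^ j * (1 - C * q ^ (M - y - Suc j))))"
    proof (rule prod.cong[OF refl])
      fix j assume "j \<in> {..<b - y}"
      then have "y + j < M" using y by auto
      then obtain d where M: "M = Suc (y + j + d)" using less_imp_Suc_add by blast
      show "q ^ y * (E - P * q ^ (j + y)) = - (P * q ^ (2 * y) * q ^ j * (1 - C * q ^ (M - y - Suc j)))"
        using q0 unfolding E_def M mult_2 power_add
        by (simp add: power_add algebra_simps)
    qed
    finally show ?thesis ..
  qed
  ultimately show ?thesis
    by (simp only: eq_divide_eq not_False_eq_True if_True) (simp only: mult_ac)
qed

text \<open>At a = 0 the outer polynomial on the left and the inner ones on the right reduce to
  their norms. Expanding each (q^(-b);q)_k of the remaining sum by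
  \<open>sum_shifted_products_eq_qpoch\<close> and exchanging sums leaves the q-Racah sum over k;
  \<open>f y\<close> collects its prefactor and the top-degree product.\<close>

lemma connection_on_edge:
  fixes A B C :: real
  assumes P: "\<And>j. j + 2 \<le> 2 * M \<Longrightarrow> A * B * q ^ j \<noteq> 1"
    and E: "\<And>j. j < M \<Longrightarrow> A * B * C * q ^ M / q * q ^ j \<noteq> 1"
    and b: "b \<le> M" and w: "w \<le> M"
  shows "hahn q A (B * C * q ^ (2 * w)) (M - w) 0 (M - w) * hahn q B C w b (M - b)
    = (\<Sum>y\<le>M. q_Racah y w (B / q) (A / q) (B * C * q ^ M / q) M q
        * (hahn q (A * B * q ^ (2 * y)) C (M - y) (b - y) (M - b) * hahn q A B y 0 b))"
proof -
  let ?g = "qpoch q q"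
  define E where "E = A * B * C * q ^ M / q"
  define P where "P = A * B"
  define \<kappa> where "\<kappa> k = hahn_coeff q w B (B * C) k / qpoch (inverse (q ^ M)) q k" for k
  define f where "f y = ?g b / (?g y * ?g (b - y)) * qpoch E q y
            * (\<Prod>j=y..<b. E - P * q ^ j)
            / (qpoch (P * q ^ y / q) q y * qpoch (P * q ^ (2 * y)) q (b - y))" for y
  define g where "g y k = qpoch (inverse (q ^ y)) q k * qpoch (P * q ^ y / q) q k / qpoch E q k" for y k
  have g0: "g y k = 0" if "y < k" for y k
    using qpoch_inverse_qpow_eq_0[OF that] by (simp add: g_def)
  have \<kappa>0: "\<kappa> k = 0" if "w < k" for k
    using qpoch_inverse_qpow_eq_0[OF that] by (simp add: \<kappa>_def hahn_coeff_def)
  have gnz [simp]: "?g n \<noteq> 0" for n by (rule qpoch_q_nonzero)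
  let ?L = "hahn q A (B * C * q ^ (2 * w)) (M - w) 0 (M - w) * hahn q B C w b (M - b)"
  have "?L = hahn_norm q (M - w) (M - w) * hahn_norm q w M * hahn_sum q w B (B * C) b M"
    using b w by (simp add: hahn_def hahn_sum_0)
  also have "hahn_norm q (M - w) (M - w) * hahn_norm q w M = hahn_norm q M M"
    using hahn_norm_mult[of w M M] w by simp
  also have "hahn_sum q w B (B * C) b M = (\<Sum>k\<le>w. \<kappa> k * qpoch (inverse (q ^ b)) q k)"
    by (simp add: hahn_sum_def \<kappa>_def)
  \<comment> \<open>The vanishing terms make the range of k independent of w and of y, so that the
    sums can be exchanged.\<close>
  also have "\<dots> = (\<Sum>k\<le>M. \<kappa> k * qpoch (inverse (q ^ b)) q k)"
    using w by (intro sum.mono_neutral_left) (auto simp: \<kappa>0)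
  also have "\<dots> = (\<Sum>k\<le>M. \<kappa> k * (\<Sum>y\<le>b. f y * g y k))"
  proof (rule sum.cong[OF refl])
    fix k assume "k \<in> {..M}"
    then have "qpoch E q k \<noteq> 0"
      using E by (intro qpoch_nonzero) (auto simp: E_def)
    then have "(\<Sum>y\<le>b. f y * g y k) = qpoch (inverse (q ^ b)) q k"
      unfolding f_def g_def
      using assms(1) b by (intro sum_shifted_products_eq_qpoch) (auto simp: P_def)
    then show "\<kappa> k * qpoch (inverse (q ^ b)) q k = \<kappa> k * (\<Sum>y\<le>b. f y * g y k)" by simp
  qed
  also have "\<dots> = (\<Sum>k\<le>M. \<Sum>y\<le>b. f y * (\<kappa> k * g y k))"
    by (simp add: sum_distrib_left mult_ac)
  also have "\<dots> = (\<Sum>y\<le>b. f y * (\<Sum>k\<le>M. \<kappa> k * g y k))"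
    by (subst sum.swap) (simp add: sum_distrib_left)
  also have "hahn_norm q M M * \<dots> = (\<Sum>y\<le>b. hahn_norm q M M * f y * (\<Sum>k\<le>M. \<kappa> k * g y k))"
    by (simp add: sum_distrib_left mult_ac)
  also have "\<dots> = (\<Sum>y\<le>b. q_Racah y w (B / q) (A / q) (B * C * q ^ M / q) M q
        * (hahn q (A * B * q ^ (2 * y)) C (M - y) (b - y) (M - b) * hahn q A B y 0 b))"
  proof (rule sum.cong[OF refl])
    fix y assume "y \<in> {..b}"
    then have y: "y \<le> b" by simp
    have "?g M = ?g (M - y) * qpoch (q ^ Suc (M - y)) q y"
      using qpoch_add[of q q "M - y" y] y b by simp
    moreover have "q ^ (y * (M - y)) = q ^ (y * (M - b)) * q ^ (y * (b - y))"
      using y b by (simp add: power_add[symmetric] distrib_left[symmetric])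
    moreover have "(\<Sum>k\<le>M. \<kappa> k * g y k) = (\<Sum>k\<le>y. \<kappa> k * g y k)"
      using y b by (intro sum.mono_neutral_right) (auto simp: g0)
    then have r: "q_Racah y w (B / q) (A / q) (B * C * q ^ M / q) M q
     = qpoch E q y * qpoch (q ^ Suc (M - y)) q y
        / (q ^ (y * (M - y)) * (qpoch (P * q ^ y / q) q y * ?g y)) * (\<Sum>k\<le>M. \<kappa> k * g y k)"
      using q_Racah_eq[of y M w B A C] y b unfolding E_def P_def \<kappa>_def g_def by simp
    have h0: "hahn q A B y 0 b = hahn_norm q y b"
      using y by (simp add: hahn_def hahn_sum_0)
    have h: "hahn q (A * B * q ^ (2 * y)) C (M - y) (b - y) (M - b) * hahn q A B y 0 b
      = (hahn_norm q (M - y) (M - y) * hahn_norm q y b) * q ^ (y * (b - y)) * (\<Prod>j=y..<b. E - P * q ^ j)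
      / qpoch (P * q ^ (2 * y)) q (b - y)"
      using hahn_top_degree_product[of M "A * B" y b C] assms(1) y b unfolding h0 by (simp add: P_def E_def)
    have Mnz: "qpoch (q ^ Suc (M - y)) q y \<noteq> 0" 
      using calculation(1) gnz[of M] by (metis mult_zero_right)
    show "hahn_norm q M M * f y * (\<Sum>k\<le>M. \<kappa> k * g y k) = q_Racah y w (B / q) (A / q) (B * C * q ^ M / q) M q
        * (hahn q (A * B * q ^ (2 * y)) C (M - y) (b - y) (M - b) * hahn q A B y 0 b)"
      unfolding r h hahn_norm_mult[OF y b] calculation f_def using q0 Mnz
      by (simp del: power_Suc) (simp only: mult_ac)
  qed
  also have "\<dots> = (\<Sum>y\<le>M. q_Racah y w (B / q) (A / q) (B * C * q ^ M / q) M q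
        * (hahn q (A * B * q ^ (2 * y)) C (M - y) (b - y) (M - b) * hahn q A B y 0 b))"
    using b by (intro sum.mono_neutral_left) (auto simp: hahn_def)
  finally show ?thesis .
qed

section \<open>Raising and lowering nested polynomials\<close>

lemma raise3_right_nested:
  assumes "w \<le> M" "M \<le> a + b + c"
  shows "raise3 q (right_nested q A B C M w) a b c
       = q ^ M * (1 - q ^ (a + b + c - M)) * right_nested q A B C M w a b c"
proof (cases "w \<le> b + c")
  case False
  then show ?thesis
    by (auto simp: raise3_def right_nested_def hahn_def)
next
  case True
  define d where "d = b + c - w"
  let ?g = "hahn q A (B * C * q ^ (2 * w)) (M - w)" and ?h = "hahn q B C w"
  have e1: "(1 - q ^ a) * right_nested q A B C M w (a - 1) b c
      = (1 - q ^ a) * ?g (a - 1) d * ?h b c * q ^ w / q ^ (w * a)"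
    using q0 by (cases a) (simp_all add: right_nested_def d_def power_add)
  have e2: "(1 - q ^ b) * right_nested q A B C M w a (b - 1) c
      = (1 - q ^ b) * ?h (b - 1) c * (?g a (d - 1) / q ^ (w * a))"
    using q0 by (cases b) (simp_all add: right_nested_def d_def)
  have e3: "(1 - q ^ c) * right_nested q A B C M w a b (c - 1)
      = (1 - q ^ c) * ?h b (c - 1) * (?g a (d - 1) / q ^ (w * a))"
    using q0 by (cases c) (simp_all add: right_nested_def d_def)
  have "raise3 q (right_nested q A B C M w) a b c
     = (1 - q ^ a) * right_nested q A B C M w (a - 1) b c
       + q ^ a * ((1 - q ^ b) * right_nested q A B C M w a (b - 1) c
           + q ^ b * ((1 - q ^ c) * right_nested q A B C M w a b (c - 1)))"
    by (simp add: raise3_def mult.assoc)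
  also have "\<dots> = (1 - q ^ a) * ?g (a - 1) d * ?h b c * q ^ w / q ^ (w * a)
      + q ^ a * (((1 - q ^ b) * ?h (b - 1) c + q ^ b * (1 - q ^ c) * ?h b (c - 1)) * (?g a (d - 1) / q ^ (w * a)))"
    unfolding e1 e2 e3 distrib_right by (simp add: mult_ac)
  \<comment> \<open>The inner raising constant q^w (1 - q^d) supplies the weight 1 - q^d of the
    merged box. Its q^w matches the q^w that q^(-w a) releases when a drops by one.\<close>
  also have "\<dots> = ((1 - q ^ a) * ?g (a - 1) d + q ^ a * (1 - q ^ d) * ?g a (d - 1)) * (q ^ w * ?h b c / q ^ (w * a))"
    unfolding hahn_raise[where n = w] distrib_right by (simp add: d_def mult_ac)
  also have "\<dots> = q ^ (M - w) * (1 - q ^ (a + d - (M - w))) * ?g a d * (q ^ w * ?h b c / q ^ (w * a))"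
    unfolding hahn_raise ..
  also have "\<dots> = (q ^ (M - w) * q ^ w) * (1 - q ^ (a + d - (M - w))) * right_nested q A B C M w a b c"
    by (simp add: right_nested_def d_def mult_ac)
  also have "q ^ (M - w) * q ^ w = q ^ M"
    using assms by (simp flip: power_add)
  also have "a + d - (M - w) = a + b + c - M"
    using assms True by (simp add: d_def)
  finally show ?thesis .
qed

lemma raise3_left_nested:
  assumes "y \<le> M" "M \<le> a + b + c"
  shows "raise3 q (left_nested q A B C M y) a b c
       = q ^ M * (1 - q ^ (a + b + c - M)) * left_nested q A B C M y a b c"
proof -
  define x where "x = a + b - y"
  let ?g = "hahn q (A * B * q ^ (2 * y)) C (M - y)" and ?h = "hahn q A B y"
  have e1: "(1 - q ^ a) * left_nested q A B C M y (a - 1) b c = (1 - q ^ a) * ?h (a - 1) b * ?g (x - 1) c"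
    by (cases a) (simp_all add: left_nested_def x_def)
  have e2: "(1 - q ^ b) * left_nested q A B C M y a (b - 1) c = (1 - q ^ b) * ?h a (b - 1) * ?g (x - 1) c"
    by (cases b) (simp_all add: left_nested_def x_def)
  have "raise3 q (left_nested q A B C M y) a b c
     = (1 - q ^ a) * left_nested q A B C M y (a - 1) b c
       + q ^ a * ((1 - q ^ b) * left_nested q A B C M y a (b - 1) c)
       + q ^ a * q ^ b * (1 - q ^ c) * left_nested q A B C M y a b (c - 1)"
    by (simp add: raise3_def distrib_left mult.assoc)
  also have "\<dots> = ((1 - q ^ a) * ?h (a - 1) b + q ^ a * (1 - q ^ b) * ?h a (b - 1)) * ?g (x - 1) c
       + q ^ (a + b) * (1 - q ^ c) * (?g x (c - 1) * ?h a b)"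
    unfolding e1 e2 distrib_right power_add by (simp add: left_nested_def x_def mult_ac)
  also have "\<dots> = (q ^ y * (1 - q ^ x) * ?g (x - 1) c + q ^ (a + b) * (1 - q ^ c) * ?g x (c - 1)) * ?h a b"
    unfolding hahn_raise[where n = y] distrib_right by (simp add: x_def mult_ac)
  also have "\<dots> = q ^ M * (1 - q ^ (a + b + c - M)) * (?g x c * ?h a b)"
  proof (cases "y \<le> a + b")
    case False
    then show ?thesis by (simp add: hahn_def)
  next
    case True
    then have "q ^ (a + b) = q ^ y * q ^ x" by (simp add: x_def flip: power_add)
    then have "q ^ y * (1 - q ^ x) * ?g (x - 1) c + q ^ (a + b) * (1 - q ^ c) * ?g x (c - 1)
      = q ^ y * ((1 - q ^ x) * ?g (x - 1) c + q ^ x * (1 - q ^ c) * ?g x (c - 1))"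
      by (simp add: distrib_left mult.assoc)
    also have "\<dots> = (q ^ y * q ^ (M - y)) * (1 - q ^ (x + c - (M - y))) * ?g x c"
      unfolding hahn_raise by simp
    also have "q ^ y * q ^ (M - y) = q ^ M" using assms by (simp flip: power_add)
    also have "x + c - (M - y) = a + b + c - M" using assms True by (simp add: x_def)
    finally show ?thesis by simp
  qed
  finally show ?thesis by (simp add: left_nested_def x_def)
qed

text \<open>The inner lowering constant is (1 - B C q^(2w) q^d) / q^w, the coefficient of a box with
  parameter B C q^(2w) and content d, so the outer lowering applies. Its degree M - w exceeds a + d,
  which gives 0.\<close>

lemma lower3_right_nested:
  assumes M: "Suc (a + b + c) = M"
    and A: "\<And>j. j < M \<Longrightarrow> A * q ^ j \<noteq> 1" and B: "\<And>j. j < M \<Longrightarrow> B * q ^ j \<noteq> 1"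
    and w: "w \<le> M"
  shows "lower3 q A B C (right_nested q A B C M w) a b c = 0"
proof -
  define d where "d = b + c - w"
  let ?g = "hahn q A (B * C * q ^ (2 * w)) (M - w)" and ?h = "hahn q B C w"
  have h: "(1 - B * q ^ b) * ?h (Suc b) c + B * q ^ b * (1 - C * q ^ c) * ?h b (Suc c)
      = (1 - B * C * q ^ (w + b + c)) / q ^ w * ?h b c"
    using B w by (intro hahn_lower) simp
  have "lower3 q A B C (right_nested q A B C M w) a b c
     = ((1 - A * q ^ a) * ?g (Suc a) d * ?h b c / q ^ w
       + A * q ^ a * ?g a (Suc (b + c) - w) * ((1 - B * q ^ b) * ?h (Suc b) c + B * q ^ b * (1 - C * q ^ c) * ?h b (Suc c))) / q ^ (w * a)"
    using q0 by (simp add: lower3_def right_nested_def d_def power_add field_simps)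
  also have "\<dots> = 0"
  proof (cases "w \<le> b + c")
    case False
    then have "?h b c = 0" by (simp add: hahn_def)
    then show ?thesis unfolding h by simp
  next
    case True
    have Sd: "Suc (b + c) - w = Suc d" using True by (simp add: d_def)
    have P: "B * C * q ^ (w + b + c) = B * C * q ^ (2 * w) * q ^ d"
    proof -
      have "w + b + c = 2 * w + d" using True by (simp add: d_def)
      then show ?thesis by (simp only: power_add mult.assoc)
    qed
    have "a + d < M - w" using True M by (simp add: d_def)
    then have "?g a d = 0" by (simp add: hahn_def)
    then have "(1 - A * q ^ a) * ?g (Suc a) d + A * q ^ a * (1 - B * C * q ^ (2 * w) * q ^ d) * ?g a (Suc d) = 0"
      using hahn_lower[of "M - w" A a "B * C * q ^ (2 * w)" d] A by simp
    then have "((1 - A * q ^ a) * ?g (Suc a) d + A * q ^ a * (1 - B * C * q ^ (2 * w) * q ^ d) * ?g a (Suc d)) * (?h b c / q ^ w) = 0"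
      by simp
    then show ?thesis
      unfolding h Sd P distrib_right by (simp add: mult_ac)
  qed
  finally show ?thesis .
qed

text \<open>Here the merged box comes first: the inner constant becomes the leading coefficient 1 -
  A B q^(2y) q^x, and the weight A B q^(a+b) of the third box is A B q^(2y) q^x / q^y.\<close>

lemma lower3_left_nested:
  assumes M: "Suc (a + b + c) = M"
    and A: "\<And>j. j < M \<Longrightarrow> A * q ^ j \<noteq> 1" and P: "\<And>j. j + 2 \<le> 2 * M \<Longrightarrow> A * B * q ^ j \<noteq> 1"
    and y: "y \<le> M"
  shows "lower3 q A B C (left_nested q A B C M y) a b c = 0"
proof -
  let ?g = "hahn q (A * B * q ^ (2 * y)) C (M - y)" and ?h = "hahn q A B y"
  have h: "(1 - A * q ^ a) * ?h (Suc a) b + A * q ^ a * (1 - B * q ^ b) * ?h a (Suc b)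
      = (1 - A * B * q ^ (y + a + b)) / q ^ y * ?h a b"
    using A y by (intro hahn_lower) simp
  have "lower3 q A B C (left_nested q A B C M y) a b c
     = ?g (Suc (a + b) - y) c * ((1 - A * q ^ a) * ?h (Suc a) b + A * q ^ a * (1 - B * q ^ b) * ?h a (Suc b))
       + A * B * q ^ (a + b) * (1 - C * q ^ c) * ?g (a + b - y) (Suc c) * ?h a b"
    by (simp add: lower3_def left_nested_def power_add distrib_left)
  also have "\<dots> = 0"
  proof (cases "y \<le> a + b")
    case False
    then have "?h a b = 0" by (simp add: hahn_def)
    then show ?thesis unfolding h by simp
  next
    case True
    define x where "x = a + b - y"
    have x: "Suc (a + b) - y = Suc x" "a + b = x + y" using True by (simp_all add: x_def)
    have 1: "A * B * q ^ (y + a + b) = A * B * q ^ (2 * y) * q ^ x"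
    proof -
      have "y + a + b = 2 * y + x" using True by (simp add: x_def)
      then show ?thesis by (simp only: power_add mult.assoc)
    qed
    have 2: "A * B * q ^ (a + b) = A * B * q ^ (2 * y) * q ^ x / q ^ y"
      using q0 by (simp add: x(2) mult_2 power_add)
    have "x + c < M - y" using True M by (simp add: x_def)
    then have "?g x c = 0" by (simp add: hahn_def)
    moreover have "A * B * q ^ (2 * y) * q ^ j \<noteq> 1" if "j < M - y" for j
      using P[of "2 * y + j"] that y by (simp add: power_add mult.assoc)
    ultimately have "(1 - A * B * q ^ (2 * y) * q ^ x) * ?g (Suc x) c
        + A * B * q ^ (2 * y) * q ^ x * (1 - C * q ^ c) * ?g x (Suc c) = 0"
      using hahn_lower[of "M - y" "A * B * q ^ (2 * y)" x C c] by simp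
    then have "((1 - A * B * q ^ (2 * y) * q ^ x) * ?g (Suc x) c
        + A * B * q ^ (2 * y) * q ^ x * (1 - C * q ^ c) * ?g x (Suc c)) * (?h a b / q ^ y) = 0"
      by simp
    then show ?thesis
      unfolding h x(1) 1 2 x_def[symmetric] distrib_right by (simp add: mult_ac)
  qed
  finally show ?thesis .
qed

lemma right_nested_eq_sum_left_nested:
  fixes A B C :: real
  assumes A: "\<And>j. j < M \<Longrightarrow> A * q ^ j \<noteq> 1" and B: "\<And>j. j < M \<Longrightarrow> B * q ^ j \<noteq> 1"
    and P: "\<And>j. j + 2 \<le> 2 * M \<Longrightarrow> A * B * q ^ j \<noteq> 1"
    and E: "\<And>j. j < M \<Longrightarrow> A * B * C * q ^ M / q * q ^ j \<noteq> 1"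
    and w: "w \<le> M" and M: "M \<le> a + b + c"
  shows "right_nested q A B C M w a b c
    = (\<Sum>y\<le>M. q_Racah y w (B / q) (A / q) (B * C * q ^ M / q) M q * left_nested q A B C M y a b c)"
proof -
  define r where "r y = q_Racah y w (B / q) (A / q) (B * C * q ^ M / q) M q" for y
  let ?F = "right_nested q A B C M w"
  define G where "G = (\<lambda>a b c. \<Sum>y\<le>M. r y * left_nested q A B C M y a b c)"
  have top: "?F a b c = G a b c" if "a + b + c = M" for a b c
    using that
  proof (induction a arbitrary: b c)
    case 0
    then have "b + c - w = M - w" "c = M - b" "b \<le> M" by auto
    then show ?case
      using connection_on_edge[OF P E, of b w] w
      by (simp add: right_nested_def left_nested_def G_def r_def)
  next
    case (Suc a)
    have M: "Suc (a + b + c) = M" using Suc.prems by simp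
    have "lower3 q A B C ?F a b c = 0"
      by (rule lower3_right_nested[OF M A B w])
    moreover have "lower3 q A B C G a b c = 0"
      unfolding G_def lower3_sum
      by (intro sum.neutral ballI) (simp add: lower3_left_nested[OF M A P])
    moreover have "?F a (Suc b) c = G a (Suc b) c" "?F a b (Suc c) = G a b (Suc c)"
      using Suc.IH M by simp_all
    ultimately have "(1 - A * q ^ a) * ?F (Suc a) b c = (1 - A * q ^ a) * G (Suc a) b c"
      by (simp only: lower3_def)
    moreover have "1 - A * q ^ a \<noteq> 0" using A[of a] M by simp
    ultimately show ?case by simp
  qed
  have "?F a b c = G a b c" if "a + b + c = M + d" for d a b c
    using that
  proof (induction d arbitrary: a b c)
    case 0
    then show ?case using top by simp
  next
    case (Suc d)
    let ?c = "q ^ M * (1 - q ^ (a + b + c - M))"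
    \<comment> \<open>An empty box drops out through its factor 1 - q^0, so the induction hypothesis
      is applied to genuine predecessors only.\<close>
    have "raise3 q ?F a b c = raise3 q G a b c"
    proof -
      have "(1 - q ^ a) * ?F (a - 1) b c = (1 - q ^ a) * G (a - 1) b c"
        using Suc by (cases a) simp_all
      moreover have "(1 - q ^ b) * ?F a (b - 1) c = (1 - q ^ b) * G a (b - 1) c"
        using Suc by (cases b) simp_all
      moreover have "(1 - q ^ c) * ?F a b (c - 1) = (1 - q ^ c) * G a b (c - 1)"
        using Suc by (cases c) simp_all
      ultimately show ?thesis unfolding raise3_def by (simp only: mult.assoc)
    qed
    moreover have "raise3 q ?F a b c = ?c * ?F a b c"
      using Suc.prems by (intro raise3_right_nested w) simp
    moreover have "raise3 q G a b c = ?c * G a b c"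
      unfolding G_def raise3_sum sum_distrib_left
      using Suc.prems by (intro sum.cong refl) (simp add: raise3_left_nested)
    moreover have "?c \<noteq> 0"
      using qpow_eq_1_iff[of "a + b + c - M"] Suc.prems q0 by simp
    ultimately show ?case using q0 by simp
  qed
  from this[of a b c "a + b + c - M"] M show ?thesis by (simp add: G_def r_def)
qed

end

section \<open>Labeled trees\<close>

lemma psum_add: "psum x (s + t) = psum x s + psum (drop s x) t"
  by (simp add: psum_def take_add)

lemma pprod_add: "pprod \<alpha> (s + t) = pprod \<alpha> s * pprod (drop s \<alpha>) t"
  by (simp add: pprod_def take_add)

lemma leaves_pos: "0 < leaves T"
  by (induction T) auto

text \<open>A positive label needs an internal vertex. The exponent bound in
  \<open>subtree_parameter_gt_1\<close> can fail for one leaf with positive label sum, and this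
  excludes that case.\<close>

lemma leaves_ge_2_of_label_sum: "0 < label_sum c \<Longrightarrow> 2 \<le> leaves (tree_of c)"
proof -
  have "2 \<le> leaves T + leaves T'" for T T'
    using add_mono[of 1 "leaves T" 1 "leaves T'"] by (simp add: Suc_le_eq leaves_pos)
  then show "0 < label_sum c \<Longrightarrow> 2 \<le> leaves (tree_of c)"
    by (cases c) auto
qed

text \<open>The guard n \<le> X_h is absorbed by the value 0 of \<open>hahn\<close> beyond the
  total, so only the conditions on i and j remain.\<close>

lemma multi_q_Hahn_LNode:
  fixes q :: real
  assumes q: "0 < q" "q < 1" and pos: "pprod \<alpha> t \<noteq> 0"
    and t: "leaves (tree_of c1) = t" "leaves (tree_of c2) = t'"
    and ij: "label_sum c1 = i" "label_sum c2 = j"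
  shows "multi_q_Hahn q (LNode m c1 c2) \<alpha> x =
     (if i \<le> psum x t \<and> j \<le> psum (drop t x) t' then
        hahn q (pprod \<alpha> t * q ^ (t + 2 * i)) (pprod (drop t \<alpha>) t' * q ^ (t' + 2 * j)) m
          (psum x t - i) (psum (drop t x) t' - j) / q ^ (j * psum x t)
        * multi_q_Hahn q c1 (take t \<alpha>) (take t x) * multi_q_Hahn q c2 (drop t \<alpha>) (drop t x)
      else 0)"
proof -
  define X Y where "X = psum x t" and "Y = psum (drop t x) t'"
  define A B where "A = pprod \<alpha> t * q ^ (t + 2 * i)" and "B = pprod (drop t \<alpha>) t' * q ^ (t' + 2 * j)"
  have p1: "pprod \<alpha> t * q powi (int t + 2 * int i - 1) = A / q"
  proof -
    have "q powi (int t + 2 * int i - 1) = q powi (int (t + 2 * i)) / q"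
      using q by (subst power_int_diff) auto
    then show ?thesis by (simp only: power_int_of_nat A_def times_divide_eq_right)
  qed
  have p2: "pprod \<alpha> (t + t') * inverse (pprod \<alpha> t) * q powi (int (t + t') - int t + 2 * int j - 1) = B / q"
  proof -
    have e: "int (t + t') - int t + 2 * int j - 1 = int (t' + 2 * j) - 1" by simp
    have "q powi (int (t + t') - int t + 2 * int j - 1) = q powi (int (t' + 2 * j)) / q"
      unfolding e using q by (subst power_int_diff) auto
    then show ?thesis using pos by (simp only: power_int_of_nat) (simp add: B_def pprod_add)
  qed
  have p3: "q powi - (int j * int X) = inverse (q ^ (j * X))"
    by (simp only: power_int_minus power_int_of_nat flip: of_nat_mult)
  have "multi_q_Hahn q (LNode m c1 c2) \<alpha> x =
      (if m + i + j \<le> X + Y \<and> i \<le> X \<and> j \<le> Y then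
         inverse (q ^ (j * X)) * q_Hahn m (X - i) (A / q) (B / q) (X + Y - i - j) q
         * multi_q_Hahn q c1 (take t \<alpha>) (take t x) * multi_q_Hahn q c2 (drop t \<alpha>) (drop t x) else 0)"
    unfolding multi_q_Hahn.simps Let_def label_sum.simps t ij psum_add X_def[symmetric] Y_def[symmetric] p1 p2 p3
    by simp
  also have "\<dots> = (if i \<le> X \<and> j \<le> Y then
         hahn q A B m (X - i) (Y - j) / q ^ (j * X)
         * multi_q_Hahn q c1 (take t \<alpha>) (take t x) * multi_q_Hahn q c2 (drop t \<alpha>) (drop t x) else 0)"
  proof (cases "i \<le> X \<and> j \<le> Y")
    case True
    show ?thesis
    proof (cases "m + i + j \<le> X + Y")
      case le: True
      have 1: "X + Y - i - j - (X - i) = Y - j" using True by simp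
      have "q_Hahn m (X - i) (A / q) (B / q) (X + Y - i - j) q = hahn q A B m (X - i) (Y - j)"
        using le True by (subst hahn_eq_q_Hahn[OF q]) (auto simp: 1)
      then show ?thesis
        using le True by (simp only: simp_thms if_True) (simp add: divide_inverse mult_ac)
    next
      case False
      then have "\<not> m \<le> (X - i) + (Y - j)" using True by arith
      then have "hahn q A B m (X - i) (Y - j) = 0" by (simp add: hahn_def)
      then show ?thesis using False by simp
    qed
  qed auto
  finally show ?thesis unfolding X_def Y_def A_def B_def .
qed

text \<open>The root exponent (w+l+j)(a+i) splits as w a + w i + (l+j)(a+i): the first part belongs
  to \<open>right_nested\<close>, the second is the origin of q^(-i(v-l-j)) in the theorem, the
  third occurs for the other tree too.\<close>

lemma multi_q_Hahn_right_nested: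
  fixes q :: real
  assumes q: "0 < q" "q < 1" and nz: "pprod \<alpha> s \<noteq> 0" "pprod (drop s \<alpha>) t \<noteq> 0"
    and leaves: "leaves (tree_of c') = s" "leaves (tree_of c'') = t" "leaves (tree_of c''') = u"
    and labels: "label_sum c' = i" "label_sum c'' = l" "label_sum c''' = j"
    and sums: "psum x s = a + i" "psum (drop s x) t = b + l" "psum (drop (s + t) x) u = c + j"
    and w: "w \<le> M"
  shows "multi_q_Hahn q (LNode (M - w) c' (LNode w c'' c''')) \<alpha> x =
     right_nested q (pprod \<alpha> s * q ^ (s + 2 * i)) (pprod (drop s \<alpha>) t * q ^ (t + 2 * l))
        (pprod (drop (s + t) \<alpha>) u * q ^ (u + 2 * j)) M w a b c
     * (multi_q_Hahn q c' (take s \<alpha>) (take s x)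
        * multi_q_Hahn q c'' (take t (drop s \<alpha>)) (take t (drop s x))
        * multi_q_Hahn q c''' (drop (s + t) \<alpha>) (drop (s + t) x)
        / (q ^ (w * i) * q ^ ((l + j) * (a + i)) * q ^ (j * (b + l))))"
proof -
  define B C where "B = pprod (drop s \<alpha>) t * q ^ (t + 2 * l)" and "C = pprod (drop (s + t) \<alpha>) u * q ^ (u + 2 * j)"
  let ?m = "multi_q_Hahn q"
  have d1: "drop t (drop s \<alpha>) = drop (s + t) \<alpha>" "drop t (drop s x) = drop (s + t) x"
    by (simp_all add: add.commute)
  have ps: "psum (drop s x) (t + u) = b + l + (c + j)"
    unfolding psum_add d1 sums ..
  have inner: "?m (LNode w c'' c''') (drop s \<alpha>) (drop s x) =
    hahn q B C w b c / q ^ (j * (b + l)) * ?m c'' (take t (drop s \<alpha>)) (take t (drop s x))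
      * ?m c''' (drop (s + t) \<alpha>) (drop (s + t) x)"
    unfolding multi_q_Hahn_LNode[OF q nz(2) leaves(2,3) labels(2,3)] d1 sums B_def C_def by simp
  have BC: "pprod (drop s \<alpha>) (t + u) * q ^ ((t + u) + 2 * (w + l + j)) = B * C * q ^ (2 * w)"
    unfolding pprod_add d1 B_def C_def by (simp add: power_add distrib_left)
  have outer: "?m (LNode (M - w) c' (LNode w c'' c''')) \<alpha> x =
     (if w + l + j \<le> b + l + (c + j) then
      hahn q (pprod \<alpha> s * q ^ (s + 2 * i)) (B * C * q ^ (2 * w)) (M - w) a (b + l + (c + j) - (w + l + j))
       / q ^ ((w + l + j) * (a + i)) * ?m c' (take s \<alpha>) (take s x) * ?m (LNode w c'' c''') (drop s \<alpha>) (drop s x)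
      else 0)"
    using multi_q_Hahn_LNode[OF q nz(1) leaves(1), of "LNode w c'' c'''" "t + u" i "w + l + j" "M - w" x]
    unfolding ps BC sums using leaves labels by simp
  have pw: "q ^ ((w + l + j) * (a + i)) = q ^ (w * a) * (q ^ (w * i) * q ^ ((l + j) * (a + i)))"
    by (simp add: algebra_simps flip: power_add)
  show ?thesis
  proof (cases "w \<le> b + c")
    case False
    then have "hahn q B C w b c = 0" by (simp add: hahn_def)
    then show ?thesis
      using False unfolding outer right_nested_def B_def[symmetric] C_def[symmetric] by simp
  next
    case True
    then have "w + l + j \<le> b + l + (c + j)" "b + l + (c + j) - (w + l + j) = b + c - w" by simp_all
    then show ?thesis
      unfolding outer inner right_nested_def B_def[symmetric] C_def[symmetric] pw
      by (simp add: mult_ac)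
  qed
qed

text \<open>Since j(a+i+b+l) + l(a+i) = (l+j)(a+i) + j(b+l), the remaining powers are those of
  \<open>multi_q_Hahn_right_nested\<close> except for q^(w i).\<close>

lemma multi_q_Hahn_left_nested:
  fixes q :: real
  assumes q: "0 < q" "q < 1" and nz: "pprod \<alpha> s \<noteq> 0" "pprod (drop s \<alpha>) t \<noteq> 0"
    and leaves: "leaves (tree_of c') = s" "leaves (tree_of c'') = t" "leaves (tree_of c''') = u"
    and labels: "label_sum c' = i" "label_sum c'' = l" "label_sum c''' = j"
    and sums: "psum x s = a + i" "psum (drop s x) t = b + l" "psum (drop (s + t) x) u = c + j"
    and y: "y \<le> M"
  shows "multi_q_Hahn q (LNode (M - y) (LNode y c' c'') c''') \<alpha> x =
     left_nested q (pprod \<alpha> s * q ^ (s + 2 * i)) (pprod (drop s \<alpha>) t * q ^ (t + 2 * l))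
        (pprod (drop (s + t) \<alpha>) u * q ^ (u + 2 * j)) M y a b c
     * (multi_q_Hahn q c' (take s \<alpha>) (take s x)
        * multi_q_Hahn q c'' (take t (drop s \<alpha>)) (take t (drop s x))
        * multi_q_Hahn q c''' (drop (s + t) \<alpha>) (drop (s + t) x)
        / (q ^ ((l + j) * (a + i)) * q ^ (j * (b + l))))"
proof -
  define A B where "A = pprod \<alpha> s * q ^ (s + 2 * i)" and "B = pprod (drop s \<alpha>) t * q ^ (t + 2 * l)"
  let ?m = "multi_q_Hahn q"
  have d1: "take s (take (s + t) \<alpha>) = take s \<alpha>" "take s (take (s + t) x) = take s x"
    "drop s (take (s + t) \<alpha>) = take t (drop s \<alpha>)" "drop s (take (s + t) x) = take t (drop s x)"
    by (simp_all add: drop_take)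
  have ps: "psum (take (s + t) x) s = a + i" "psum (take t (drop s x)) t = b + l" "psum x (s + t) = a + i + (b + l)"
    using sums unfolding psum_add by (simp_all add: psum_def)
  have pp: "pprod (take (s + t) \<alpha>) s = pprod \<alpha> s" "pprod (take t (drop s \<alpha>)) t = pprod (drop s \<alpha>) t"
    by (simp_all add: pprod_def)
  have nz': "pprod (take (s + t) \<alpha>) s \<noteq> 0" "pprod \<alpha> (s + t) \<noteq> 0"
    using nz by (simp_all add: pp pprod_add)
  have inner: "?m (LNode y c' c'') (take (s + t) \<alpha>) (take (s + t) x) =
    hahn q A B y a b / q ^ (l * (a + i)) * ?m c' (take s \<alpha>) (take s x)
      * ?m c'' (take t (drop s \<alpha>)) (take t (drop s x))"
    unfolding multi_q_Hahn_LNode[OF q nz'(1) leaves(1,2) labels(1,2)] d1 ps pp A_def B_def by simp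
  have AB: "pprod \<alpha> (s + t) * q ^ ((s + t) + 2 * (y + i + l)) = A * B * q ^ (2 * y)"
    unfolding pprod_add A_def B_def by (simp add: power_add distrib_left)
  have outer: "?m (LNode (M - y) (LNode y c' c'') c''') \<alpha> x =
     (if y + i + l \<le> a + i + (b + l) then
      hahn q (A * B * q ^ (2 * y)) (pprod (drop (s + t) \<alpha>) u * q ^ (u + 2 * j)) (M - y) (a + i + (b + l) - (y + i + l)) c
       / q ^ (j * (a + i + (b + l))) * ?m (LNode y c' c'') (take (s + t) \<alpha>) (take (s + t) x)
       * ?m c''' (drop (s + t) \<alpha>) (drop (s + t) x)
      else 0)"
    using multi_q_Hahn_LNode[OF q nz'(2), of "LNode y c' c''" c''' u "y + i + l" j "M - y" x]
    unfolding ps AB sums using leaves labels by simp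
  have pw: "q ^ (j * (a + i + (b + l))) * q ^ (l * (a + i)) = q ^ ((l + j) * (a + i)) * q ^ (j * (b + l))"
    by (simp add: algebra_simps flip: power_add)
  show ?thesis
  proof (cases "y \<le> a + b")
    case False
    then have "hahn q A B y a b = 0" by (simp add: hahn_def)
    then show ?thesis
      using False unfolding outer left_nested_def A_def[symmetric] B_def[symmetric] by simp
  next
    case True
    then have "y + i + l \<le> a + i + (b + l)" "a + i + (b + l) - (y + i + l) = a + b - y" by simp_all
    then show ?thesis
      unfolding outer inner left_nested_def A_def[symmetric] B_def[symmetric] pw[symmetric]
      by (simp add: mult_ac)
  qed
qed

text \<open>A box smaller than its label sum violates a guard in either tree, at the root or one
  level below. In all other cases the reduced contents a, b, c exist.\<close>

lemma multi_q_Hahn_nested_eq_0: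
  fixes q :: real
  assumes q: "0 < q" "q < 1" and nz: "pprod \<alpha> s \<noteq> 0" "pprod (drop s \<alpha>) t \<noteq> 0"
    and leaves: "leaves (tree_of c') = s" "leaves (tree_of c'') = t" "leaves (tree_of c''') = u"
    and small: "psum x s < label_sum c' \<or> psum (drop s x) t < label_sum c'' \<or> psum (drop (s + t) x) u < label_sum c'''"
  shows "multi_q_Hahn q (LNode m c' (LNode w c'' c''')) \<alpha> x = 0"
    and "multi_q_Hahn q (LNode m (LNode w c' c'') c''') \<alpha> x = 0"
proof -
  have d1: "drop t (drop s x) = drop (s + t) x" "drop s (take (s + t) x) = take t (drop s x)"
    by (simp_all add: drop_take add.commute)
  have ps: "psum (take (s + t) x) s = psum x s" "psum (take t (drop s x)) t = psum (drop s x) t"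
    by (simp_all add: psum_def)
  have nz': "pprod (take (s + t) \<alpha>) s \<noteq> 0" "pprod \<alpha> (s + t) \<noteq> 0"
    using nz by (simp_all add: pprod_add) (simp_all add: pprod_def)
  have 1: "multi_q_Hahn q (LNode w c'' c''') (drop s \<alpha>) (drop s x) = 0"
    if "psum (drop s x) t < label_sum c'' \<or> psum (drop (s + t) x) u < label_sum c'''"
    unfolding multi_q_Hahn_LNode[OF q nz(2) leaves(2,3) refl refl] d1 using that by auto
  show "multi_q_Hahn q (LNode m c' (LNode w c'' c''')) \<alpha> x = 0"
    unfolding multi_q_Hahn_LNode[OF q nz(1) leaves(1) refl refl refl] using small 1 by (auto simp del: multi_q_Hahn.simps)
  have 2: "multi_q_Hahn q (LNode w c' c'') (take (s + t) \<alpha>) (take (s + t) x) = 0"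
    if "psum x s < label_sum c' \<or> psum (drop s x) t < label_sum c''"
    unfolding multi_q_Hahn_LNode[OF q nz'(1) leaves(1,2) refl refl] d1 ps using that by auto
  have st: "leaves (tree_of (LNode w c' c'')) = s + t" by (simp add: leaves)
  show "multi_q_Hahn q (LNode m (LNode w c' c'') c''') \<alpha> x = 0"
    unfolding multi_q_Hahn_LNode[OF q nz'(2) st leaves(3) refl refl] using small 2 by (auto simp del: multi_q_Hahn.simps)
qed

section \<open>Non-vanishing of the denominators\<close>

lemma prod_list_pos:
  fixes \<beta> :: "real list"
  shows "(\<And>b. b \<in> set \<beta> \<Longrightarrow> 0 < b) \<Longrightarrow> 0 < prod_list \<beta>"
  by (induction \<beta>) auto

lemma power_length_less_prod_list:
  fixes r :: real
  assumes "0 < r" "\<beta> \<noteq> []" "\<And>b. b \<in> set \<beta> \<Longrightarrow> r < b"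
  shows "r ^ length \<beta> < prod_list \<beta>"
  using assms(2,3)
proof (induction \<beta>)
  case (Cons b \<beta>)
  have b: "r < b" using Cons.prems by simp
  with assms(1) have "0 < b" by (rule less_trans)
  show ?case
  proof (cases "\<beta> = []")
    case False
    then have "r * r ^ length \<beta> < b * prod_list \<beta>"
      using Cons b \<open>0 < b\<close> assms(1) by (intro mult_strict_mono) auto
    then show ?thesis by simp
  qed (use b in simp)
qed simp

lemma prod_list_times_power_less_1:
  fixes q :: real
  assumes "0 < q" "\<beta> \<noteq> []" "\<And>b. b \<in> set \<beta> \<Longrightarrow> 0 < b \<and> b < inverse q"
  shows "0 < prod_list \<beta> \<and> prod_list \<beta> * q ^ length \<beta> < 1"
  using assms(2,3)
proof (induction \<beta>)
  case (Cons b \<beta>)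
  have b: "0 < b" "b * q < 1" using Cons.prems(2)[of b] assms(1) by (auto simp: field_simps)
  show ?case
  proof (cases "\<beta> = []")
    case False
    then have IH: "0 < prod_list \<beta>" "prod_list \<beta> * q ^ length \<beta> < 1" using Cons by auto
    then have "(b * q) * (prod_list \<beta> * q ^ length \<beta>) < 1 * 1"
      using b assms(1) by (intro mult_strict_mono) auto
    then show ?thesis using b IH by (simp add: mult_ac)
  qed (use b in simp)
qed simp

text \<open>The product exceeds q^(-N t), so t + 2i + k \<le> N t suffices. As k + i + 1 \<le> N, it
  is enough to have 2i + k \<le> (k+i) t: clear for i = 0, and true for i > 0 because then t \<ge>
  2.\<close>

lemma subtree_parameter_gt_1:
  fixes q :: real
  assumes q: "0 < q" "q < 1" and len: "length \<beta> = leaves (tree_of c)"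
    and \<beta>: "\<And>b. b \<in> set \<beta> \<Longrightarrow> inverse (q ^ N) < b" and k: "k + label_sum c < N"
  shows "1 < prod_list \<beta> * q ^ (leaves (tree_of c) + 2 * label_sum c) * q ^ k"
proof -
  define t i where "t = leaves (tree_of c)" and "i = label_sum c"
  have t: "0 < t" unfolding t_def by (rule leaves_pos)
  have "t + 2 * i + k \<le> N * t"
  proof (cases "i = 0")
    case True
    have "k + t \<le> k * t + t" using t by simp
    also have "\<dots> \<le> N * t" using k t True by (metis Suc_leI add.commute add_0_right i_def mult_Suc mult_le_mono1)
    finally show ?thesis using True by simp
  next
    case False
    then have "2 \<le> t" using leaves_ge_2_of_label_sum[of c] by (simp add: t_def i_def)
    then have "(k + i) * 2 \<le> (k + i) * t" by (rule mult_le_mono2)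
    then have "t + 2 * i + k \<le> (k + i) * t + t" by simp
    also have "\<dots> \<le> N * t" using k by (metis Suc_leI add.commute i_def mult_Suc mult_le_mono1)
    finally show ?thesis .
  qed
  then have "q ^ (N * t) \<le> q ^ (t + 2 * i + k)"
    using q by (intro power_decreasing) auto
  then have "1 \<le> inverse (q ^ N) ^ t * q ^ (t + 2 * i + k)"
    using q by (simp add: power_mult field_simps)
  also have "\<dots> < prod_list \<beta> * q ^ (t + 2 * i + k)"
  proof -
    have "inverse (q ^ N) ^ t < prod_list \<beta>"
      unfolding t_def len[symmetric]
    proof (rule power_length_less_prod_list)
      show "\<beta> \<noteq> []" using len t by (auto simp: t_def)
    qed (use q \<beta> in auto)
    then show ?thesis using q by simp
  qed
  finally show ?thesis by (simp add: t_def i_def power_add mult_ac)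
qed

lemma subtree_parameter_less_1:
  fixes q :: real
  assumes q: "0 < q" "q < 1" and len: "length \<beta> = leaves (tree_of c)"
    and \<beta>: "\<And>b. b \<in> set \<beta> \<Longrightarrow> 0 < b \<and> b < inverse q"
  shows "prod_list \<beta> * q ^ (leaves (tree_of c) + 2 * label_sum c) < 1"
proof -
  have "\<beta> \<noteq> []" using len leaves_pos[of "tree_of c"] by auto
  then have "0 < prod_list \<beta>" "prod_list \<beta> * q ^ length \<beta> < 1"
    using prod_list_times_power_less_1[OF q(1)] \<beta> by auto
  moreover have "q ^ (2 * label_sum c) \<le> 1" using q by (simp add: power_le_one)
  ultimately have "prod_list \<beta> * q ^ length \<beta> * q ^ (2 * label_sum c) \<le> prod_list \<beta> * q ^ length \<beta> * 1"
    using q by (intro mult_left_mono) auto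
  then show ?thesis using \<open>prod_list \<beta> * q ^ length \<beta> < 1\<close> len by (simp add: power_add mult_ac)
qed

text \<open>These are the conditions of \<open>right_nested_eq_sum_left_nested\<close>. In the first
  range every product stays below 1; in the second the power of q is distributed over the parameters
  so that each receives an exponent below M.\<close>

lemma no_resonance:
  fixes A B C q :: real
  assumes q: "0 < q" "q < 1" and pos: "0 < A" "0 < B" "0 < C"
    and regime: "A < 1 \<and> B < 1 \<and> C < 1 \<or> (\<forall>k<M. 1 < A * q ^ k \<and> 1 < B * q ^ k \<and> 1 < C * q ^ k)"
  shows "j < M \<Longrightarrow> A * q ^ j \<noteq> 1" and "j < M \<Longrightarrow> B * q ^ j \<noteq> 1"
    and "j + 2 \<le> 2 * M \<Longrightarrow> A * B * q ^ j \<noteq> 1"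
    and "j < M \<Longrightarrow> A * B * C * q ^ M / q * q ^ j \<noteq> 1"
proof -
  have le: "z * q ^ k \<le> z" if "0 < z" for z :: real and k
    using that q by (simp add: power_le_one mult_left_le)
  have lt: "y * z < 1" if "0 < y" "y < 1" "0 < z" "z < 1" for y z :: real
    using mult_strict_mono[of y 1 z 1] that by simp
  have gt: "1 < y * z" if "1 < y" "1 < z" for y z :: real
    using that by (rule less_1_mult)
  have "j < M \<Longrightarrow> A * q ^ j < 1 \<or> 1 < A * q ^ j"
    using regime le[OF pos(1), of j] by auto
  then show "j < M \<Longrightarrow> A * q ^ j \<noteq> 1" by auto
  have "j < M \<Longrightarrow> B * q ^ j < 1 \<or> 1 < B * q ^ j"
    using regime le[OF pos(2), of j] by auto
  then show "j < M \<Longrightarrow> B * q ^ j \<noteq> 1" by auto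
  show "A * B * q ^ j \<noteq> 1" if j: "j + 2 \<le> 2 * M"
    using regime
  proof
    assume "A < 1 \<and> B < 1 \<and> C < 1"
    then have "A * B < 1" using pos by (intro lt) auto
    moreover have "A * B * q ^ j \<le> A * B" by (rule le) (simp add: pos)
    ultimately have "A * B * q ^ j < 1" by (rule le_less_trans[rotated])
    then show ?thesis by simp
  next
    assume *: "\<forall>k<M. 1 < A * q ^ k \<and> 1 < B * q ^ k \<and> 1 < C * q ^ k"
    \<comment> \<open>As j \<le> 2M - 2, both d and j - d are below M.\<close>
    define d where "d = min j (M - 1)"
    have "d < M" "j - d < M" "j = d + (j - d)" using j by (auto simp: d_def)
    then have "1 < (A * q ^ d) * (B * q ^ (j - d))"
      using gt[of "A * q ^ d" "B * q ^ (j - d)"] * by blast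
    also have "\<dots> = A * B * q ^ (d + (j - d))" by (simp add: power_add)
    also have "d + (j - d) = j" using \<open>j = d + (j - d)\<close> by simp
    finally show ?thesis by simp
  qed
  show "A * B * C * q ^ M / q * q ^ j \<noteq> 1" if j: "j < M"
  proof -
    obtain d where d: "M = Suc d" using j by (cases M) auto
    \<comment> \<open>The exponent M - 1 + j is shared out as M - 1 for A, j for B and 0 for
      C.\<close>
    have e: "A * B * C * q ^ M / q * q ^ j = (A * q ^ d) * (B * q ^ j) * (C * q ^ 0)"
      using q by (simp add: d)
    have e': "A * B * C * q ^ M / q * q ^ j = (A * B * C) * q ^ (d + j)"
      using q by (simp add: d power_add)
    show ?thesis
      using regime
    proof
      assume "A < 1 \<and> B < 1 \<and> C < 1"
      then have "A * B * C < 1" using pos by (intro lt) auto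
      moreover have "A * B * C * q ^ (d + j) \<le> A * B * C" by (rule le) (simp add: pos)
      ultimately have "A * B * C * q ^ (d + j) < 1" by (rule le_less_trans[rotated])
      then show ?thesis unfolding e' by simp
    next
      assume *: "\<forall>k<M. 1 < A * q ^ k \<and> 1 < B * q ^ k \<and> 1 < C * q ^ k"
      have "1 < A * q ^ d" "1 < B * q ^ j" "1 < C * q ^ 0"
        using *[rule_format, of d] *[rule_format, of j] *[rule_format, of 0] j d by auto
      from gt[OF gt[OF this(1,2)] this(3)] show ?thesis unfolding e by simp
    qed
  qed
qed

section \<open>Transplantation of an edge\<close>

theorem mainTheorem5:
  fixes q :: real and \<alpha> :: "real list" and h N s r n i l j v :: nat
    and T' T'' T''' :: bintree and c' c'' c''' :: labeling
  assumes "0 < q" "q < 1" "3 \<le> h" "1 \<le> N"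
    and "length \<alpha> = h"
    and "(\<forall>k<h. 0 < \<alpha> ! k \<and> \<alpha> ! k < inverse q) \<or> (\<forall>k<h. \<alpha> ! k > q powi (- int N))"
    and "1 \<le> s" "s < r" "r < h"
    and "leaves T' = s" "leaves T'' = r - s" "leaves T''' = h - r"
    and "n \<le> N" "i + l + j \<le> n"
    and "c' \<in> CL T' i" "c'' \<in> CL T'' l" "c''' \<in> CL T''' j"
    and "l + j \<le> v" "v \<le> n - i"
  shows "\<forall>x \<in> compositions h N.
    q_Hahn_V q (LNode (n - v - i) c' (LNode (v - l - j) c'' c''')) \<alpha> x =
    complex_of_real (q powi (- (int i * (int v - int l - int j)))) *
    (\<Sum>u = i + l..n - j.
       complex_of_real
         (q_Racah (u - i - l) (v - l - j)
           (inverse (pprod \<alpha> s) * pprod \<alpha> r * q powi (int r - int s + 2 * int l - 1))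
           (pprod \<alpha> s * q powi (int s + 2 * int i - 1))
           (inverse (pprod \<alpha> s) * pprod \<alpha> h
             * q powi (int n + int l + int j - int i + int h - int s - 1))
           (n - i - l - j) q)
       * q_Hahn_V q (LNode (n - u - j) (LNode (u - i - l) c' c'') c''') \<alpha> x)"
proof
  fix x assume "x \<in> compositions h N"
  then have x: "length x = h" "sum_list x = N" by (auto simp: compositions_def)
  note q = assms(1,2)
  define t u M w where "t = r - s" and "u = h - r" and "M = n - i - l - j" and "w = v - l - j"
  have sizes: "r = s + t" "h = s + t + u" "n = M + i + l + j" "v = w + l + j" "w \<le> M"
    using assms(3-19) by (simp_all add: t_def u_def M_def w_def)
  have leaves: "leaves (tree_of c') = s" "leaves (tree_of c'') = t" "leaves (tree_of c''') = u"
    and labels: "label_sum c' = i" "label_sum c'' = l" "label_sum c''' = j"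
    using assms by (auto simp: CL_def t_def u_def)
  define \<beta>1 \<beta>2 \<beta>3 where "\<beta>1 = take s \<alpha>" and "\<beta>2 = take t (drop s \<alpha>)" and "\<beta>3 = take u (drop (s + t) \<alpha>)"
  have len: "length \<beta>1 = leaves (tree_of c')" "length \<beta>2 = leaves (tree_of c'')" "length \<beta>3 = leaves (tree_of c''')"
    using assms(5) sizes leaves by (simp_all add: \<beta>1_def \<beta>2_def \<beta>3_def)
  have sub: "set \<beta>1 \<subseteq> set \<alpha>" "set \<beta>2 \<subseteq> set \<alpha>" "set \<beta>3 \<subseteq> set \<alpha>"
    unfolding \<beta>1_def \<beta>2_def \<beta>3_def by (meson set_drop_subset set_take_subset subset_trans)+
  have regime: "(\<forall>b\<in>set \<alpha>. 0 < b \<and> b < inverse q) \<or> (\<forall>b\<in>set \<alpha>. inverse (q ^ N) < b)"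
    using assms(5,6) by (auto simp: all_set_conv_all_nth power_int_minus)
  then have "\<forall>b\<in>set \<alpha>. 0 < b"
    using q by (auto intro: less_trans[of 0 "inverse (q ^ N)"])
  then have pos: "0 < prod_list \<beta>1" "0 < prod_list \<beta>2" "0 < prod_list \<beta>3"
    using sub by (auto intro!: prod_list_pos)
  have pp: "pprod \<alpha> s = prod_list \<beta>1" "pprod (drop s \<alpha>) t = prod_list \<beta>2" "pprod (drop (s + t) \<alpha>) u = prod_list \<beta>3"
    by (simp_all add: pprod_def \<beta>1_def \<beta>2_def \<beta>3_def)
  define A B C where "A = pprod \<alpha> s * q ^ (s + 2 * i)" and "B = pprod (drop s \<alpha>) t * q ^ (t + 2 * l)"
    and "C = pprod (drop (s + t) \<alpha>) u * q ^ (u + 2 * j)"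
  have ABC: "0 < A" "0 < B" "0 < C"
    using pos q by (simp_all add: A_def B_def C_def pp)
  have "A < 1 \<and> B < 1 \<and> C < 1 \<or> (\<forall>k<M. 1 < A * q ^ k \<and> 1 < B * q ^ k \<and> 1 < C * q ^ k)"
    using regime
  proof
    assume "\<forall>b\<in>set \<alpha>. 0 < b \<and> b < inverse q"
    then show ?thesis
      using sub subtree_parameter_less_1[OF q len(1)] subtree_parameter_less_1[OF q len(2)]
        subtree_parameter_less_1[OF q len(3)]
      unfolding A_def B_def C_def pp leaves labels by blast
  next
    assume *: "\<forall>b\<in>set \<alpha>. inverse (q ^ N) < b"
    have "1 < A * q ^ k \<and> 1 < B * q ^ k \<and> 1 < C * q ^ k" if "k < M" for k
    proof -
      have "k + i < N" "k + l < N" "k + j < N" using that sizes assms(13) by simp_all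
      then show ?thesis
        using * sub subtree_parameter_gt_1[OF q len(1), of N k] subtree_parameter_gt_1[OF q len(2), of N k]
          subtree_parameter_gt_1[OF q len(3), of N k]
        unfolding A_def B_def C_def pp leaves labels by blast
    qed
    then show ?thesis by blast
  qed
  note nores = no_resonance[OF q ABC this]
  have nz: "pprod \<alpha> s \<noteq> 0" "pprod (drop s \<alpha>) t \<noteq> 0" using pos by (simp_all add: pp)
  let ?m = "multi_q_Hahn q"
  define R where "R y = q_Racah y w (B / q) (A / q) (B * C * q ^ M / q) M q" for y
  have real: "?m (LNode (M - w) c' (LNode w c'' c''')) \<alpha> x
     = inverse (q ^ (i * w)) * (\<Sum>y\<le>M. R y * ?m (LNode (M - y) (LNode y c' c'') c''') \<alpha> x)"
  proof (cases "i \<le> psum x s \<and> l \<le> psum (drop s x) t \<and> j \<le> psum (drop (s + t) x) u")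
    case False
    then have "psum x s < label_sum c' \<or> psum (drop s x) t < label_sum c'' \<or> psum (drop (s + t) x) u < label_sum c'''"
      using labels by auto
    from multi_q_Hahn_nested_eq_0[OF q nz leaves this] show ?thesis
      by (simp del: multi_q_Hahn.simps)
  next
    case True
    then obtain a b c where sums: "psum x s = a + i" "psum (drop s x) t = b + l" "psum (drop (s + t) x) u = c + j"
      by (metis le_add_diff_inverse2)
    have "psum x h = N" using x by (simp add: psum_def)
    then have "a + i + (b + l) + (c + j) = N"
      unfolding sizes psum_add sums by simp
    then have "M \<le> a + b + c" using assms(13) sizes by simp
    then have "right_nested q A B C M w a b c = (\<Sum>y\<le>M. R y * left_nested q A B C M y a b c)"
      unfolding R_def by (intro right_nested_eq_sum_left_nested[OF q nores sizes(5)])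
    then show ?thesis
      unfolding multi_q_Hahn_right_nested[OF q nz leaves labels sums sizes(5)]
      by (simp add: multi_q_Hahn_left_nested[OF q nz leaves labels sums] A_def B_def C_def
          sum_distrib_left sum_distrib_right sum_divide_distrib divide_inverse mult_ac
          del: multi_q_Hahn.simps)
  qed
  have p1: "inverse (pprod \<alpha> s) * pprod \<alpha> r * q powi (int r - int s + 2 * int l - 1) = B / q"
  proof -
    have e: "int r - int s + 2 * int l - 1 = int (t + 2 * l) - 1" by (simp add: sizes)
    have "q powi (int r - int s + 2 * int l - 1) = q ^ (t + 2 * l) / q"
      unfolding e using q by (subst power_int_diff) (auto simp only: power_int_of_nat power_int_1_right)
    then show ?thesis using nz by (simp add: B_def sizes(1) pprod_add)
  qed
  have p2: "pprod \<alpha> s * q powi (int s + 2 * int i - 1) = A / q"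
  proof -
    have e: "int s + 2 * int i - 1 = int (s + 2 * i) - 1" by simp
    have "q powi (int s + 2 * int i - 1) = q ^ (s + 2 * i) / q"
      unfolding e using q by (subst power_int_diff) (auto simp only: power_int_of_nat power_int_1_right)
    then show ?thesis by (simp add: A_def)
  qed
  have p3: "inverse (pprod \<alpha> s) * pprod \<alpha> h * q powi (int n + int l + int j - int i + int h - int s - 1)
      = B * C * q ^ M / q"
  proof -
    have e: "int n + int l + int j - int i + int h - int s - 1 = int ((t + 2 * l) + (u + 2 * j) + M) - 1"
      by (simp add: sizes)
    have "q powi (int n + int l + int j - int i + int h - int s - 1) = q ^ ((t + 2 * l) + (u + 2 * j) + M) / q"
      unfolding e using q by (subst power_int_diff) (auto simp only: power_int_of_nat power_int_1_right)
    moreover have "pprod \<alpha> h = pprod \<alpha> s * pprod (drop s \<alpha>) t * pprod (drop (s + t) \<alpha>) u"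
      by (simp only: sizes(2) pprod_add)
    ultimately show ?thesis using nz by (simp add: B_def C_def power_add)
  qed
  have p4: "q powi (- (int i * (int v - int l - int j))) = inverse (q ^ (i * w))"
  proof -
    have "int i * (int v - int l - int j) = int (i * w)" by (simp add: sizes)
    then show ?thesis by (simp only: power_int_minus power_int_of_nat)
  qed
  have "(\<Sum>k = i + l..n - j. q_Racah (k - i - l) w (B / q) (A / q) (B * C * q ^ M / q) M q
        * ?m (LNode (n - k - j) (LNode (k - i - l) c' c'') c''') \<alpha> x)
     = (\<Sum>k = 0 + (i + l)..M + (i + l). R (k - i - l) * ?m (LNode (n - k - j) (LNode (k - i - l) c' c'') c''') \<alpha> x)"
    unfolding R_def by (rule sum.cong) (simp_all add: sizes)
  also have "\<dots> = (\<Sum>y = 0..M. R y * ?m (LNode (M - y) (LNode y c' c'') c''') \<alpha> x)"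
    unfolding sum.shift_bounds_cl_nat_ivl by (rule sum.cong) (simp_all add: sizes)
  finally have sum: "(\<Sum>k = i + l..n - j. q_Racah (k - i - l) w (B / q) (A / q) (B * C * q ^ M / q) M q
        * ?m (LNode (n - k - j) (LNode (k - i - l) c' c'') c''') \<alpha> x)
     = (\<Sum>y\<le>M. R y * ?m (LNode (M - y) (LNode y c' c'') c''') \<alpha> x)"
    by (simp add: atLeast0AtMost)
  have root: "n - v - i = M - w" by (simp add: sizes)
  show "q_Hahn_V q (LNode (n - v - i) c' (LNode (v - l - j) c'' c''')) \<alpha> x =
    complex_of_real (q powi (- (int i * (int v - int l - int j)))) *
    (\<Sum>u = i + l..n - j.
       complex_of_real
         (q_Racah (u - i - l) (v - l - j)
           (inverse (pprod \<alpha> s) * pprod \<alpha> r * q powi (int r - int s + 2 * int l - 1))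
           (pprod \<alpha> s * q powi (int s + 2 * int i - 1))
           (inverse (pprod \<alpha> s) * pprod \<alpha> h
             * q powi (int n + int l + int j - int i + int h - int s - 1))
           (n - i - l - j) q)
       * q_Hahn_V q (LNode (n - u - j) (LNode (u - i - l) c' c'') c''') \<alpha> x)"
    unfolding p1 p2 p3 p4 root q_Hahn_V_def w_def[symmetric] M_def[symmetric]
      of_real_mult[symmetric] of_real_sum[symmetric] of_real_eq_iff sum by (rule real)
qed

end
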